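(* Let $A$ be a rectified first-order formula. The following two statements are logically equivalent. Moreover, we can construct a witness for each statement from a witness for the other one. 1. There is a positive natural number $n$ such that $A$ has Property C of order $n$. 2. There is a sentential tautology $B$, and there is a derivation of $A$ from $B$ that consists in applications of the generalized rules of simplification, $\gamma$-quantification, and $\delta^-$-quantification (and in the renaming of bound variables).
   Context: Formulas are formulas of first-order logic without equality with sentential connectives $\neg,\vee,\wedge$ and quantifiers $\forall,\exists$. A formula is rectified if it contains no vacuous quantifier, no variable has both free and bound occurrences in it, and no two quantifiers bind occurrences of the same variable. A quantifier occurrence is a $\gamma$-quantifier if it is existential in the scope of an even number of negation symbols, or universal in the scope of an odd number of negation symbols; otherwise it is a $\delta$-quantifier. A quantifier is accessible in a formula if it is in the scope of no quantifier of that formula. Sentential tautology: a first-order formula that is quantifier-free and truth-functionally valid, its atomic subformulas being read as atomic sentential variables. Height: $|f(t_1,\ldots,t_m)| = 1+\max\{0,|t_1|,\ldots,|t_m|\}$; constants are nullary function symbols, and free variables are treated like constants (so both have height $1$). For a positive natural number $n$ and a formula $F$, $\mathcal T_n(F)$ is the set of terms $t$ with $|t|<n$ built from the function symbols, constants and free variables occurring free in $F$; if neither constants nor free variables occur in $F$, a fresh constant $\bullet$ is added. So $\mathcal T_1(F)=\emptyset$. Expansion: for a finite set $\mathcal T$ of terms and a rectified formula $F$ whose bound variables do not occur in $\mathcal T$, the expansion $F^{\mathcal T}$ is defined recursively: $F^{\mathcal T}=F$ for quantifier-free $F$; it commutes with $\neg,\vee,\wedge$; $(\exists x.F')^{\mathcal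 T}=\bigvee_{t\in\mathcal T}F'^{\mathcal T}\{x\mapsto t\}$; $(\forall x.F')^{\mathcal T}=\bigwedge_{t\in\mathcal T}F'^{\mathcal T}\{x\mapsto t\}$. Empty disjunctions and conjunctions are not admitted, so $F^{\emptyset}$ is defined only if $F$ contains no quantifier. Outer Skolemized form of a rectified formula $B$: remove every $\delta$-quantifier and replace its bound variable $y$ with $y^\delta(x_1,\ldots,x_m)$, where $y^\delta$ is a fresh (Skolem) symbol and $x_1,\ldots,x_m$, in this order, are exactly the variables of the $\gamma$-quantifiers in whose scope the $\delta$-quantifier occurs. Property C of order $n$: a rectified formula $A$ has it iff $F^{\mathcal T_n(F)}$ is (defined and) a sentential tautology, where $F$ is the outer Skolemized form of $A$. Inference rules (from premise to conclusion; $A[\ldots]$ is a formula context, $Q\in\{\forall,\exists\}$): - Generalized rule of $\gamma$-quantification: from $A[H\{x\mapsto t\}]$ infer $A[Qx.H]$, where $Qx.$ is an accessible $\gamma$-quantifier of $A[Qx.H]$, $t$ is a term, and the free variables of $t$ must not be bound by quantifiers in $H$ (here $H\{x\mapsto t\}$ replaces all occurrences of $x$ in $H$ with $t$ without renaming; an implicit renaming of bound variables in $H$ is admitted to satisfy the side condition). - Generalized rule of $\delta^-$-quantification: from $A[H]$ infer $A[Qy.H]$, where $Qy.$ is an accessible $\delta$-quantifier of $A[Qy.H]$ and the variable $y$ must not occur free in the context $A[\ldots]$ (an implicit renaming of the bound $y$ is admitted). - Generalized rule of simplification: from $A[H\circ H']$ infer $A[H]$, where $\circ$ is $\vee$ if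 $[\ldots]$ is a positive position in $A[\ldots]$ (in the scope of an even number of negation symbols) and $\wedge$ if it is negative, and $H'$ is a variant of $H$ (i.e. $H'$ is $H$ up to renaming of variables bound in $H$). *)

theory Defs
  imports Main "HOL-Library.While_Combinator"
begin

section \<open>First-order formulas without equality\<close>

text \<open>
  Arities are given by use: the function symbol of \<open>Fun f ts\<close> is the pair
  \<open>(f, length ts)\<close>, and likewise for predicate symbols in \<open>Atom p ts\<close>. Constants are the
  function symbols of arity 0.
\<close>

datatype 'f tm = Var nat | Fun 'f "'f tm list"

datatype quant = Forall | Exists

datatype ('f, 'p) fm =
    Atom 'p "'f tm list"
  | Neg "('f, 'p) fm"
  | Or "('f, 'p) fm" "('f, 'p) fm"
  | And "('f, 'p) fm" "('f, 'p) fm"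
  | Qt quant nat "('f, 'p) fm"

fun fv_tm :: "'f tm \<Rightarrow> nat set" where
  "fv_tm (Var x) = {x}"
| "fv_tm (Fun f ts) = (\<Union>t\<in>set ts. fv_tm t)"

fun fv :: "('f, 'p) fm \<Rightarrow> nat set" where
  "fv (Atom p ts) = (\<Union>t\<in>set ts. fv_tm t)"
| "fv (Neg H) = fv H"
| "fv (Or H K) = fv H \<union> fv K"
| "fv (And H K) = fv H \<union> fv K"
| "fv (Qt q x H) = fv H - {x}"

text \<open>The variables of all quantifier occurrences, with multiplicity.\<close>

fun quantified :: "('f, 'p) fm \<Rightarrow> nat list" where
  "quantified (Atom p ts) = []"
| "quantified (Neg H) = quantified H"
| "quantified (Or H K) = quantified H @ quantified K"
| "quantified (And H K) = quantified H @ quantified K"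
| "quantified (Qt q x H) = x # quantified H"

definition qfree :: "('f, 'p) fm \<Rightarrow> bool" where
  "qfree H \<longleftrightarrow> quantified H = []"

fun no_vacuous :: "('f, 'p) fm \<Rightarrow> bool" where
  "no_vacuous (Atom p ts) = True"
| "no_vacuous (Neg H) = no_vacuous H"
| "no_vacuous (Or H K) = (no_vacuous H \<and> no_vacuous K)"
| "no_vacuous (And H K) = (no_vacuous H \<and> no_vacuous K)"
| "no_vacuous (Qt q x H) = (x \<in> fv H \<and> no_vacuous H)"

definition rectified :: "('f, 'p) fm \<Rightarrow> bool" where
  "rectified A \<longleftrightarrow>
     no_vacuous A \<and> fv A \<inter> set (quantified A) = {} \<and> distinct (quantified A)"

text \<open>Replacement of the free occurrences of a variable, without renaming.\<close>

fun subst_tm :: "nat \<Rightarrow> 'f tm \<Rightarrow> 'f tm \<Rightarrow> 'f tm" where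
  "subst_tm x t (Var y) = (if y = x then t else Var y)"
| "subst_tm x t (Fun f ts) = Fun f (map (subst_tm x t) ts)"

fun subst :: "nat \<Rightarrow> 'f tm \<Rightarrow> ('f, 'p) fm \<Rightarrow> ('f, 'p) fm" where
  "subst x t (Atom p ts) = Atom p (map (subst_tm x t) ts)"
| "subst x t (Neg H) = Neg (subst x t H)"
| "subst x t (Or H K) = Or (subst x t H) (subst x t K)"
| "subst x t (And H K) = And (subst x t H) (subst x t K)"
| "subst x t (Qt q y H) = Qt q y (if y = x then H else subst x t H)"

text \<open>
  Equality up to renaming of bound variables. The list pairs the variables bound on the two
  sides, innermost first.
\<close>

fun same_var :: "(nat \<times> nat) list \<Rightarrow> nat \<Rightarrow> nat \<Rightarrow> bool" where
  "same_var [] x y = (x = y)"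
| "same_var ((a, b) # bs) x y =
     (if x = a \<or> y = b then x = a \<and> y = b else same_var bs x y)"

fun alpha_tm :: "(nat \<times> nat) list \<Rightarrow> 'f tm \<Rightarrow> 'f tm \<Rightarrow> bool" where
  "alpha_tm bs (Var x) (Var y) = same_var bs x y"
| "alpha_tm bs (Fun f ss) (Fun g ts) = (f = g \<and> list_all2 (alpha_tm bs) ss ts)"
| "alpha_tm bs _ _ = False"

fun alpha :: "(nat \<times> nat) list \<Rightarrow> ('f, 'p) fm \<Rightarrow> ('f, 'p) fm \<Rightarrow> bool" where
  "alpha bs (Atom p ss) (Atom r ts) = (p = r \<and> list_all2 (alpha_tm bs) ss ts)"
| "alpha bs (Neg H) (Neg H') = alpha bs H H'"
| "alpha bs (Or H K) (Or H' K') = (alpha bs H H' \<and> alpha bs K K')"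
| "alpha bs (And H K) (And H' K') = (alpha bs H H' \<and> alpha bs K K')"
| "alpha bs (Qt q x H) (Qt q' y H') = (q = q' \<and> alpha ((x, y) # bs) H H')"
| "alpha bs _ _ = False"

definition variant :: "('f, 'p) fm \<Rightarrow> ('f, 'p) fm \<Rightarrow> bool" where
  "variant H H' \<longleftrightarrow> alpha [] H H'"

text \<open>
  Truth-functional semantics. The truth value of a quantified formula is of no relevance,
  because only quantifier-free formulas can be sentential tautologies.
\<close>

fun sent_eval :: "('p \<Rightarrow> 'f tm list \<Rightarrow> bool) \<Rightarrow> ('f, 'p) fm \<Rightarrow> bool" where
  "sent_eval I (Atom p ts) = I p ts"
| "sent_eval I (Neg H) = (\<not> sent_eval I H)"
| "sent_eval I (Or H K) = (sent_eval I H \<or> sent_eval I K)"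
| "sent_eval I (And H K) = (sent_eval I H \<and> sent_eval I K)"
| "sent_eval I (Qt q x H) = undefined"

definition sentential_tautology :: "('f, 'p) fm \<Rightarrow> bool" where
  "sentential_tautology H \<longleftrightarrow> qfree H \<and> (\<forall>I. sent_eval I H)"

text \<open>
  The first argument tells whether the quantifier is in the scope of an even number of
  negation symbols. The \<open>\<delta>\<close>-quantifiers are those that are not \<open>\<gamma>\<close>-quantifiers.
\<close>

definition is_gamma :: "bool \<Rightarrow> quant \<Rightarrow> bool" where
  "is_gamma pos q \<longleftrightarrow> q = (if pos then Exists else Forall)"


section \<open>Property C\<close>

text \<open>
  The signature extended with a Skolem symbol \<open>Sko y\<close> for each variable \<open>y\<close> (unique for each
  \<open>\<delta>\<close>-quantifier of a rectified formula) and the constant \<open>Bullet\<close>.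
\<close>

datatype 'f ext = Sym 'f | Sko nat | Bullet

text \<open>
  \<open>xs\<close> lists the variables of the \<open>\<gamma>\<close>-quantifiers whose scope has been entered, outermost first.
\<close>

fun skolemize :: "bool \<Rightarrow> nat list \<Rightarrow> ('f ext, 'p) fm \<Rightarrow> ('f ext, 'p) fm" where
  "skolemize pos xs (Atom p ts) = Atom p ts"
| "skolemize pos xs (Neg H) = Neg (skolemize (\<not> pos) xs H)"
| "skolemize pos xs (Or H K) = Or (skolemize pos xs H) (skolemize pos xs K)"
| "skolemize pos xs (And H K) = And (skolemize pos xs H) (skolemize pos xs K)"
| "skolemize pos xs (Qt q y H) =
     (if is_gamma pos q then Qt q y (skolemize pos (xs @ [y]) H)
      else subst y (Fun (Sko y) (map Var xs)) (skolemize pos xs H))"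

definition outer_skolemized :: "('f, 'p) fm \<Rightarrow> ('f ext, 'p) fm" where
  "outer_skolemized A = skolemize True [] (map_fm Sym id A)"

fun height :: "'f tm \<Rightarrow> nat" where
  "height (Var x) = 1"
| "height (Fun f ts) = 1 + Max (set (0 # map height ts))"

fun syms_tm :: "'f tm \<Rightarrow> ('f \<times> nat) list" where
  "syms_tm (Var x) = []"
| "syms_tm (Fun f ts) = (f, length ts) # concat (map syms_tm ts)"

fun syms :: "('f, 'p) fm \<Rightarrow> ('f \<times> nat) list" where
  "syms (Atom p ts) = concat (map syms_tm ts)"
| "syms (Neg H) = syms H"
| "syms (Or H K) = syms H @ syms K"
| "syms (And H K) = syms H @ syms K"
| "syms (Qt q x H) = syms H"

definition term_syms :: "('f ext, 'p) fm \<Rightarrow> ('f ext \<times> nat) list" where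
  "term_syms F = remdups (syms F) @
     (if fv F = {} \<and> (\<forall>(f, m)\<in>set (syms F). m \<noteq> 0) then [(Bullet, 0)] else [])"

definition terms_below :: "nat \<Rightarrow> ('f ext, 'p) fm \<Rightarrow> 'f ext tm set" where
  "terms_below n F =
     {t. height t < n \<and> set (syms_tm t) \<subseteq> set (term_syms F) \<and> fv_tm t \<subseteq> fv F}"

fun junction :: "quant \<Rightarrow> ('f, 'p) fm list \<Rightarrow> ('f, 'p) fm" where
  "junction q [] = undefined"
| "junction q [H] = H"
| "junction q (H # K # Ks) =
     (case q of Exists \<Rightarrow> Or H (junction q (K # Ks)) | Forall \<Rightarrow> And H (junction q (K # Ks)))"

fun expand :: "'f tm list \<Rightarrow> ('f, 'p) fm \<Rightarrow> ('f, 'p) fm" where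
  "expand ts (Atom p us) = Atom p us"
| "expand ts (Neg H) = Neg (expand ts H)"
| "expand ts (Or H K) = Or (expand ts H) (expand ts K)"
| "expand ts (And H K) = And (expand ts H) (expand ts K)"
| "expand ts (Qt q x H) = junction q (map (\<lambda>t. subst x t (expand ts H)) ts)"

text \<open>
  The order of the disjuncts and conjuncts is left open; it does not matter for
  truth-functional validity.
\<close>

definition expansion :: "'f tm set \<Rightarrow> ('f, 'p) fm \<Rightarrow> ('f, 'p) fm" where
  "expansion T F = expand (SOME ts. distinct ts \<and> set ts = T) F"

definition expansion_defined :: "'f tm set \<Rightarrow> ('f, 'p) fm \<Rightarrow> bool" where
  "expansion_defined T F \<longleftrightarrow>
     finite T \<and> rectified F \<and> (\<forall>t\<in>T. fv_tm t \<inter> set (quantified F) = {}) \<and>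
     (T = {} \<longrightarrow> qfree F)"

definition property_C :: "nat \<Rightarrow> ('f, 'p) fm \<Rightarrow> bool" where
  "property_C n A \<longleftrightarrow>
     (let F = outer_skolemized A; T = terms_below n F
      in expansion_defined T F \<and> sentential_tautology (expansion T F))"


section \<open>Derivations\<close>

datatype ('f, 'p) ctx =
    Hole
  | CNeg "('f, 'p) ctx"
  | COrL "('f, 'p) ctx" "('f, 'p) fm"
  | COrR "('f, 'p) fm" "('f, 'p) ctx"
  | CAndL "('f, 'p) ctx" "('f, 'p) fm"
  | CAndR "('f, 'p) fm" "('f, 'p) ctx"
  | CQt quant nat "('f, 'p) ctx"

fun fill :: "('f, 'p) ctx \<Rightarrow> ('f, 'p) fm \<Rightarrow> ('f, 'p) fm" where
  "fill Hole H = H"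
| "fill (CNeg C) H = Neg (fill C H)"
| "fill (COrL C K) H = Or (fill C H) K"
| "fill (COrR K C) H = Or K (fill C H)"
| "fill (CAndL C K) H = And (fill C H) K"
| "fill (CAndR K C) H = And K (fill C H)"
| "fill (CQt q x C) H = Qt q x (fill C H)"

fun positive :: "('f, 'p) ctx \<Rightarrow> bool" where
  "positive Hole = True"
| "positive (CNeg C) = (\<not> positive C)"
| "positive (COrL C K) = positive C"
| "positive (COrR K C) = positive C"
| "positive (CAndL C K) = positive C"
| "positive (CAndR K C) = positive C"
| "positive (CQt q x C) = positive C"

fun accessible :: "('f, 'p) ctx \<Rightarrow> bool" where
  "accessible Hole = True"
| "accessible (CNeg C) = accessible C"
| "accessible (COrL C K) = accessible C"
| "accessible (COrR K C) = accessible C"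
| "accessible (CAndL C K) = accessible C"
| "accessible (CAndR K C) = accessible C"
| "accessible (CQt q x C) = False"

fun fv_ctx :: "('f, 'p) ctx \<Rightarrow> nat set" where
  "fv_ctx Hole = {}"
| "fv_ctx (CNeg C) = fv_ctx C"
| "fv_ctx (COrL C K) = fv_ctx C \<union> fv K"
| "fv_ctx (COrR K C) = fv K \<union> fv_ctx C"
| "fv_ctx (CAndL C K) = fv_ctx C \<union> fv K"
| "fv_ctx (CAndR K C) = fv K \<union> fv_ctx C"
| "fv_ctx (CQt q x C) = fv_ctx C - {x}"

definition doubled :: "bool \<Rightarrow> ('f, 'p) fm \<Rightarrow> ('f, 'p) fm \<Rightarrow> ('f, 'p) fm" where
  "doubled pos H H' = (if pos then Or H H' else And H H')"

datatype 'f rule = Simplification | Gamma "'f tm" | Delta | Renaming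

text \<open>
  \<open>infer r P K\<close>: the conclusion \<open>K\<close> follows from the premise \<open>P\<close> by the rule \<open>r\<close>.
  In \<open>Gamma\<close> and \<open>Delta\<close> the variants \<open>H'\<close> and \<open>Qt q z H'\<close> are the admitted implicit renamings.
\<close>

inductive infer :: "'f rule \<Rightarrow> ('f, 'p) fm \<Rightarrow> ('f, 'p) fm \<Rightarrow> bool" where
  simplification:
    "variant H H' \<Longrightarrow>
     infer Simplification (fill C (doubled (positive C) H H')) (fill C H)"
| gamma:
    "accessible C \<Longrightarrow> is_gamma (positive C) q \<Longrightarrow> variant H H' \<Longrightarrow>
     fv_tm t \<inter> set (quantified H') = {} \<Longrightarrow>
     infer (Gamma t) (fill C (subst x t H')) (fill C (Qt q x H))"
| delta:
    "accessible C \<Longrightarrow> \<not> is_gamma (positive C) q \<Longrightarrow> variant (Qt q y H) (Qt q z H') \<Longrightarrow>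
     z \<notin> fv_ctx C \<Longrightarrow>
     infer Delta (fill C H') (fill C (Qt q y H))"
| renaming:
    "variant K K' \<Longrightarrow> infer Renaming K K'"

text \<open>A derivation is the list of its steps, each given by its rule and its conclusion.\<close>

type_synonym ('f, 'p) deriv = "('f rule \<times> ('f, 'p) fm) list"

fun derivation :: "('f, 'p) fm \<Rightarrow> ('f, 'p) deriv \<Rightarrow> ('f, 'p) fm \<Rightarrow> bool" where
  "derivation B [] A = (B = A)"
| "derivation B ((r, K) # D) A = (infer r B K \<and> derivation K D A)"


section \<open>Construction of the witnesses\<close>

subsection \<open>From a derivation to an order of Property C\<close>

text \<open>
  A \<open>\<gamma>\<close>-quantification with \<open>t\<close> raises the order by at most \<open>|t|\<close>: the Skolem terms below
  the new quantifier get \<open>t\<close> as an additional argument. The other rules preserve the order.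
\<close>

definition witness_order :: "('f, 'p) deriv \<Rightarrow> nat" where
  "witness_order D =
     1 + sum_list (map (\<lambda>(r, K). case r of Gamma t \<Rightarrow> height t | _ \<Rightarrow> 0) D)"

subsection \<open>From an order of Property C to a derivation\<close>

text \<open>
  The derivation is found by applying the rules backwards, starting from \<open>A\<close>.
  Every \<open>\<gamma>\<close>-quantifier is instantiated with all terms of \<open>\<T>\<^sub>n(F)\<close>, and a \<open>\<delta>\<close>-quantifier with
  variable \<open>y\<close> that has been reached by instantiating its \<open>\<gamma>\<close>-quantifiers with
  \<open>t\<^sub>1, \<dots>, t\<^sub>m\<close> is replaced by a fresh free variable that stands for the Skolem term
  \<open>y\<^sup>\<delta>(t\<^sub>1, \<dots>, t\<^sub>m)\<close>. The premise \<open>B\<close> that results is \<open>F\<close>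
  expanded with \<open>\<T>\<^sub>n(F)\<close>, with fresh variables in place of the Skolem terms.
\<close>

text \<open>All terms of height at most \<open>k\<close> over the given variables and symbols.\<close>

fun term_list :: "nat list \<Rightarrow> ('f \<times> nat) list \<Rightarrow> nat \<Rightarrow> 'f tm list" where
  "term_list vs fs 0 = []"
| "term_list vs fs (Suc k) =
     map Var vs @ concat (map (\<lambda>(f, m). map (Fun f) (List.n_lists m (term_list vs fs k))) fs)"

text \<open>
  Terms headed by a Skolem symbol or \<open>Bullet\<close> become variables, numbered from \<open>b\<close> on
  according to their position in the list \<open>us\<close>.
\<close>

fun unskolem :: "nat \<Rightarrow> 'f ext tm list \<Rightarrow> 'f ext tm \<Rightarrow> 'f tm" where
  "unskolem b us (Var x) = Var x"
| "unskolem b us (Fun (Sym f) ts) = Fun f (map (unskolem b us) ts)"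
| "unskolem b us (Fun g ts) = Var (b + length (takeWhile (\<lambda>u. u \<noteq> Fun g ts) us))"

text \<open>
  A formula whose accessible quantifiers are annotated with the terms that have been
  substituted for the \<open>\<gamma>\<close>-quantifiers above it, outermost first, and, for a \<open>\<gamma>\<close>-quantifier,
  with the terms that are still to be substituted for it.
\<close>

datatype ('f, 'p) goal =
    GAtom 'p "'f tm list"
  | GNeg "('f, 'p) goal"
  | GOr "('f, 'p) goal" "('f, 'p) goal"
  | GAnd "('f, 'p) goal" "('f, 'p) goal"
  | GGamma bool quant nat "('f, 'p) fm" "'f ext tm list" "'f ext tm list"
  | GDelta bool quant nat "('f, 'p) fm" "'f ext tm list"

fun goal_fm :: "('f, 'p) goal \<Rightarrow> ('f, 'p) fm" where
  "goal_fm (GAtom p ts) = Atom p ts"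
| "goal_fm (GNeg g) = Neg (goal_fm g)"
| "goal_fm (GOr g h) = Or (goal_fm g) (goal_fm h)"
| "goal_fm (GAnd g h) = And (goal_fm g) (goal_fm h)"
| "goal_fm (GGamma pos q x H args ts) = Qt q x H"
| "goal_fm (GDelta pos q y H args) = Qt q y H"

fun goal_of ::
  "'f ext tm list \<Rightarrow> bool \<Rightarrow> 'f ext tm list \<Rightarrow> ('f, 'p) fm \<Rightarrow> ('f, 'p) goal" where
  "goal_of T pos args (Atom p ts) = GAtom p ts"
| "goal_of T pos args (Neg H) = GNeg (goal_of T (\<not> pos) args H)"
| "goal_of T pos args (Or H K) = GOr (goal_of T pos args H) (goal_of T pos args K)"
| "goal_of T pos args (And H K) = GAnd (goal_of T pos args H) (goal_of T pos args K)"
| "goal_of T pos args (Qt q x H) =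
     (if is_gamma pos q then GGamma pos q x H args T else GDelta pos q x H args)"

text \<open>
  Quantifiers are treated in the order of the maximal height of the terms on their branch.
  This guarantees the variable condition of \<open>\<delta>\<^sup>-\<close>-quantification: a Skolem term is higher
  than its arguments, so its variable is eliminated before a term containing it is used.
\<close>

definition level :: "'f tm list \<Rightarrow> nat" where
  "level ts = Max (set (0 # map height ts))"

fun levels :: "('f, 'p) goal \<Rightarrow> nat list" where
  "levels (GAtom p ts) = []"
| "levels (GNeg g) = levels g"
| "levels (GOr g h) = levels g @ levels h"
| "levels (GAnd g h) = levels g @ levels h"
| "levels (GGamma pos q x H args ts) = (case ts of [] \<Rightarrow> [] | t # _ \<Rightarrow> [level (args @ [t])])"
| "levels (GDelta pos q y H args) = [level args]"

text \<open>
  One backward inference at the leftmost quantifier of level \<open>k\<close>; \<open>e\<close> maps terms of the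
  extended signature to terms of the original one. A \<open>\<gamma>\<close>-quantifier with several terms to go
  is first duplicated.
\<close>

fun back_step ::
  "('f ext tm \<Rightarrow> 'f tm) \<Rightarrow> 'f ext tm list \<Rightarrow> nat \<Rightarrow> ('f, 'p) goal
    \<Rightarrow> ('f rule \<times> ('f, 'p) goal) option" where
  "back_step e T k (GAtom p ts) = None"
| "back_step e T k (GNeg g) = map_option (map_prod id GNeg) (back_step e T k g)"
| "back_step e T k (GOr g h) =
     (case back_step e T k g of
        Some (r, g') \<Rightarrow> Some (r, GOr g' h)
      | None \<Rightarrow> map_option (map_prod id (GOr g)) (back_step e T k h))"
| "back_step e T k (GAnd g h) =
     (case back_step e T k g of
        Some (r, g') \<Rightarrow> Some (r, GAnd g' h)
      | None \<Rightarrow> map_option (map_prod id (GAnd g)) (back_step e T k h))"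
| "back_step e T k (GGamma pos q x H args ts) =
     (case ts of
        [] \<Rightarrow> None
      | t # ts' \<Rightarrow>
          if level (args @ [t]) \<noteq> k then None
          else if ts' = [] then
            Some (Gamma (e t), goal_of T pos (args @ [t]) (subst x (e t) H))
          else
            Some (Simplification,
              (if pos then GOr else GAnd) (GGamma pos q x H args [t]) (GGamma pos q x H args ts')))"
| "back_step e T k (GDelta pos q y H args) =
     (if level args \<noteq> k then None
      else Some (Delta, goal_of T pos args (subst y (e (Fun (Sko y) args)) H)))"

text \<open>
  If \<open>A\<close> has Property C of order \<open>n\<close>, the resulting pair is meant to consist of a sentential
  tautology and a derivation of \<open>A\<close> from it.
\<close>

definition witness_derivation ::
  "nat \<Rightarrow> ('f, 'p) fm \<Rightarrow> ('f, 'p) fm \<times> ('f, 'p) deriv" where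
  "witness_derivation n A =
     (let F = outer_skolemized A;
          us = (\<lambda>k. term_list (sorted_list_of_set (fv F)) (term_syms F) k);
          T = sort_key height (us (n - 1));
          b = Suc (Max (insert 0 (fv A \<union> set (quantified A))));
          e = unskolem b (us n);
          (g, D) =
            while (\<lambda>(g, D). levels g \<noteq> [])
              (\<lambda>(g, D).
                 case back_step e T (Min (set (levels g))) g of
                   Some (r, g') \<Rightarrow> (g', (r, goal_fm g) # D)
                 | None \<Rightarrow> (g, D))
              (goal_of T True [] A, [])
      in (goal_fm g, D))"

end

theory Submission
  imports Defs
begin

text \<open>
  Both directions rest on one evaluation of formulas, \<open>truth\<close>, which gives the truth value of the
  expansion of the outer Skolemized form without building either: a \<open>\<gamma>\<close>-quantifier ranges over a
  set of instances, and a \<open>\<delta>\<close>-quantifier takes the value of a Skolem function applied to the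
  instances chosen for the \<open>\<gamma>\<close>-quantifiers around it. Property C of order \<open>n\<close> says that this truth
  value is true under every interpretation of the atoms, when the instances are the terms of height
  less than \<open>n\<close> and the Skolem functions are free term constructors (\<open>property_C_truth\<close>;
  without such terms, there must not be a \<open>\<gamma>\<close>-quantifier).

  From a derivation to Property C. Instead of free terms, allow any algebra together with a
  filtration \<open>G\<close> that behaves like height: a function, Skolem functions included, maps arguments in
  \<open>G k\<close> into \<open>G (Suc k)\<close>, and variables lie in \<open>G 1\<close>. Call a formula valid below \<open>m\<close> if it is true in
  all of these with instances ranging over \<open>G m\<close>. This notion applies to the unrectified formulas
  inside a derivation, because Skolem functions are attached to positions and not to variable
  names. A tautology is valid below \<open>0\<close>. Renaming and simplification keep the order, since the copies
  can be given the same Skolem functions; \<open>\<delta>\<^sup>-\<close>-quantification keeps it, since the new Skolem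
  constant serves as the value of the variable that it replaces. For \<open>\<gamma>\<close>-quantification with \<open>t\<close>,
  fixing the first argument of the Skolem functions under the new quantifier to the value of \<open>t\<close>
  yields functions that respect the filtration shifted by \<open>|t|\<close>, so that the order grows by
  \<open>|t|\<close> at most (\<open>infer_valid_below\<close>). The terms of the conclusion, filtered by height, finally are
  an algebra of this kind once everything outside of its signature is sent to some term of height
  1 (\<open>valid_below_property_C\<close>).

  From Property C to a derivation. The backward search replaces each instance of a
  \<open>\<delta>\<close>-quantifier by a variable that stands for its Skolem term, and this correspondence is
  injective. It reaches a quantifier-free formula because a weight decreases in each step, and it
  preserves the truth value of the expansion, so that the result is a tautology. Only the
  variable condition of \<open>\<delta>\<^sup>-\<close>-quantification is delicate: the variable for \<open>y\<^sup>\<delta>(t\<^sub>1, \<dots>, t\<^sub>m)\<close>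
  must not yet occur when the quantifier is reached. Since no Skolem term is treated twice, it could
  only have come in with an earlier \<open>\<gamma>\<close>-instance that contains the Skolem term and hence exceeds
  the height of \<open>t\<^sub>1, \<dots>, t\<^sub>m\<close>, but quantifiers are treated in the order of that height (\<open>reduces_fresh\<close>).
\<close>

section \<open>Truth of the Skolemized expansion\<close>

fun val_tm :: "('f \<Rightarrow> 'd list \<Rightarrow> 'd) \<Rightarrow> (nat \<Rightarrow> 'd) \<Rightarrow> 'f tm \<Rightarrow> 'd" where
  "val_tm \<phi> \<sigma> (Var x) = \<sigma> x"
| "val_tm \<phi> \<sigma> (Fun f ts) = \<phi> f (map (val_tm \<phi> \<sigma>) ts)"

text \<open>
  The polarity \<open>pos\<close> tells \<open>\<gamma>\<close>- from \<open>\<delta>\<close>-quantifiers. An instance \<open>t\<close> from \<open>T\<close> is passed to Skolem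
  functions as it is, but assigned to a variable as \<open>v t\<close>, so that terms with Skolem symbols can
  be the instances of a formula that is interpreted over terms without them. The Skolem function
  \<open>s r y\<close> of a \<open>\<delta>\<close>-quantifier is addressed by its position \<open>r\<close> and its variable \<open>y\<close>. A position
  records \<open>False\<close> for a left operand or a quantifier scope and \<open>True\<close> for a right operand;
  negations leave no trace. Descending into a subformula reindexes \<open>s\<close>, and descending into a
  \<open>\<gamma>\<close>-quantifier also supplies \<open>s\<close> with the chosen instance as its first argument.
\<close>
fun truth ::
  "('p \<Rightarrow> 'd list \<Rightarrow> bool) \<Rightarrow> ('f \<Rightarrow> 'd list \<Rightarrow> 'd) \<Rightarrow> ('a \<Rightarrow> 'd) \<Rightarrow> 'a set \<Rightarrow> bool \<Rightarrow> (nat \<Rightarrow> 'd)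
    \<Rightarrow> (bool list \<Rightarrow> nat \<Rightarrow> 'a list \<Rightarrow> 'd) \<Rightarrow> ('f, 'p) fm \<Rightarrow> bool" where
  "truth I \<phi> v T pos \<sigma> s (Atom p ts) = I p (map (val_tm \<phi> \<sigma>) ts)"
| "truth I \<phi> v T pos \<sigma> s (Neg H) = (\<not> truth I \<phi> v T (\<not> pos) \<sigma> s H)"
| "truth I \<phi> v T pos \<sigma> s (Or H K) =
     (truth I \<phi> v T pos \<sigma> (\<lambda>r. s (False # r)) H \<or> truth I \<phi> v T pos \<sigma> (\<lambda>r. s (True # r)) K)"
| "truth I \<phi> v T pos \<sigma> s (And H K) =
     (truth I \<phi> v T pos \<sigma> (\<lambda>r. s (False # r)) H \<and> truth I \<phi> v T pos \<sigma> (\<lambda>r. s (True # r)) K)"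
| "truth I \<phi> v T pos \<sigma> s (Qt q x H) =
     (if is_gamma pos q
      then (if q = Exists
            then \<exists>t\<in>T. truth I \<phi> v T pos (\<sigma>(x := v t)) (\<lambda>r y as. s (False # r) y (t # as)) H
            else \<forall>t\<in>T. truth I \<phi> v T pos (\<sigma>(x := v t)) (\<lambda>r y as. s (False # r) y (t # as)) H)
      else truth I \<phi> v T pos (\<sigma>(x := s [] x [])) (\<lambda>r. s (False # r)) H)"

text \<open>
  The variables of the \<open>\<delta>\<close>-quantifiers, each with the number of \<open>\<gamma>\<close>-quantifiers around it, which
  is the arity of its Skolem symbol.
\<close>
fun skolems :: "bool \<Rightarrow> ('f, 'p) fm \<Rightarrow> (nat \<times> nat) list" where
  "skolems pos (Atom p ts) = []"
| "skolems pos (Neg H) = skolems (\<not> pos) H"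
| "skolems pos (Or H K) = skolems pos H @ skolems pos K"
| "skolems pos (And H K) = skolems pos H @ skolems pos K"
| "skolems pos (Qt q x H) =
     (if is_gamma pos q then map (\<lambda>(y, m). (y, Suc m)) (skolems pos H)
      else (x, 0) # skolems pos H)"

lemma val_tm_hom:
  assumes "\<And>x. x \<in> fv_tm t \<Longrightarrow> h (\<sigma> x) = \<sigma>' x"
    and "\<And>f ds. (f, length ds) \<in> set (syms_tm t) \<Longrightarrow> h (\<phi> f ds) = \<phi>' f (map h ds)"
  shows "h (val_tm \<phi> \<sigma> t) = val_tm \<phi>' \<sigma>' t"
  using assms
proof (induction t)
  case (Fun f ts)
  have "map h (map (val_tm \<phi> \<sigma>) ts) = map (val_tm \<phi>' \<sigma>') ts"
    proof (simp, intro ballI Fun.IH)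
    fix t f' and ds :: "'c list"
    assume "t \<in> set ts" "(f', length ds) \<in> set (syms_tm t)"
    then show "h (\<phi> f' ds) = \<phi>' f' (map h ds)" by (intro Fun.prems(2)) auto
  qed (use Fun.prems(1) in auto)
  moreover have "h (\<phi> f (map (val_tm \<phi> \<sigma>) ts)) = \<phi>' f (map h (map (val_tm \<phi> \<sigma>) ts))"
    by (rule Fun.prems(2)) simp
  ultimately show ?case by (simp only: val_tm.simps)
qed simp

text \<open>
  A homomorphism \<open>h\<close> can be moved from the atoms into the algebra. Since it has to commute with
  operations only for symbols that occur in the formula, the case of the identity is also the
  congruence rule for \<open>truth\<close>.
\<close>
lemma truth_hom:
  assumes "\<And>t. t \<in> T \<Longrightarrow> h (v t) = v' t"
    and "\<And>x. x \<in> fv H \<Longrightarrow> h (\<sigma> x) = \<sigma>' x"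
    and "\<And>f ds. (f, length ds) \<in> set (syms H) \<Longrightarrow> h (\<phi> f ds) = \<phi>' f (map h ds)"
    and "\<And>r y as. (y, length as) \<in> set (skolems pos H) \<Longrightarrow> h (s r y as) = s' r y as"
  shows "truth (\<lambda>p ds. I p (map h ds)) \<phi> v T pos \<sigma> s H = truth I \<phi>' v' T pos \<sigma>' s' H"
  using assms
proof (induction H arbitrary: pos \<sigma> \<sigma>' s s')
  case (Atom p ts)
  have "h (val_tm \<phi> \<sigma> t) = val_tm \<phi>' \<sigma>' t" if "t \<in> set ts" for t
    proof (rule val_tm_hom)
    fix f and ds :: "'c list"
    assume "(f, length ds) \<in> set (syms_tm t)"
    with that show "h (\<phi> f ds) = \<phi>' f (map h ds)" by (intro Atom.prems(3)) auto
  qed (use that Atom.prems(2) in auto)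
  then have "map h (map (val_tm \<phi> \<sigma>) ts) = map (val_tm \<phi>' \<sigma>') ts" by simp
  then show ?case by (simp only: truth.simps)
next
  case (Neg H)
  show ?case using Neg.IH[of \<sigma> \<sigma>' "\<not> pos" s s'] Neg.prems by simp
next
  case (Or H K)
  show ?case
    using Or.IH(1)[of \<sigma> \<sigma>' pos "\<lambda>r. s (False # r)" "\<lambda>r. s' (False # r)"]
      Or.IH(2)[of \<sigma> \<sigma>' pos "\<lambda>r. s (True # r)" "\<lambda>r. s' (True # r)"] Or.prems by simp
next
  case (And H K)
  show ?case
    using And.IH(1)[of \<sigma> \<sigma>' pos "\<lambda>r. s (False # r)" "\<lambda>r. s' (False # r)"]
      And.IH(2)[of \<sigma> \<sigma>' pos "\<lambda>r. s (True # r)" "\<lambda>r. s' (True # r)"] And.prems by simp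
next
  case (Qt q x H)
  show ?case
  proof (cases "is_gamma pos q")
    case True
    have "truth (\<lambda>p ds. I p (map h ds)) \<phi> v T pos (\<sigma>(x := v t)) (\<lambda>r y as. s (False # r) y (t # as)) H
        = truth I \<phi>' v' T pos (\<sigma>'(x := v' t)) (\<lambda>r y as. s' (False # r) y (t # as)) H"
      if "t \<in> T" for t
    proof (rule Qt.IH)
      fix r y and as :: "'a list"
      assume "(y, length as) \<in> set (skolems pos H)"
      then have "(y, length (t # as)) \<in> set (skolems pos (Qt q x H))" using True by force
      then show "h (s (False # r) y (t # as)) = s' (False # r) y (t # as)" by (rule Qt.prems(4))
    qed (use that Qt.prems in auto)
    then show ?thesis using True by simp
  next
    case False
    have "truth (\<lambda>p ds. I p (map h ds)) \<phi> v T pos (\<sigma>(x := s [] x [])) (\<lambda>r. s (False # r)) H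
        = truth I \<phi>' v' T pos (\<sigma>'(x := s' [] x [])) (\<lambda>r. s' (False # r)) H"
      using False Qt.prems by (intro Qt.IH) auto
    then show ?thesis using False by simp
  qed
qed

lemma truth_cong:
  assumes "\<And>x. x \<in> fv H \<Longrightarrow> \<sigma> x = \<sigma>' x"
  shows "truth I \<phi> v T pos \<sigma> s H = truth I \<phi> v T pos \<sigma>' s H"
  using truth_hom[of T "\<lambda>d. d" v v H \<sigma> \<sigma>' \<phi> \<phi> pos s s I] assms by simp

lemma truth_subst:
  assumes "fv_tm t \<inter> set (quantified H) = {}"
  shows "truth I \<phi> v T pos \<sigma> s (subst x t H) = truth I \<phi> v T pos (\<sigma>(x := val_tm \<phi> \<sigma> t)) s H"
  using assms
proof (induction H arbitrary: pos \<sigma> s)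
  case (Atom p ts)
  have "val_tm \<phi> \<sigma> (subst_tm x t u) = val_tm \<phi> (\<sigma>(x := val_tm \<phi> \<sigma> t)) u" for u
  proof (induction u)
    case (Fun f us)
    then have "map (val_tm \<phi> \<sigma> \<circ> subst_tm x t) us = map (val_tm \<phi> (\<sigma>(x := val_tm \<phi> \<sigma> t))) us"
      using Fun by (simp del: fun_upd_apply)
    then show ?case by (simp only: subst_tm.simps val_tm.simps map_map)
  qed simp
  then show ?case by (simp add: comp_def del: fun_upd_apply)
next
  case (Qt q y H)
  have "val_tm \<phi> (\<sigma>(y := d)) t = val_tm \<phi> \<sigma> t" for d
    by (rule val_tm_hom[of t "\<lambda>d. d"]) (use Qt.prems in auto)
  then show ?case
    using Qt by (cases "y = x") (simp_all add: fun_upd_twist[of x y] del: fun_upd_apply)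
qed (auto simp: Int_Un_distrib)

text \<open>
  Renaming bound variables does not move any quantifier, so the truth value is the same as long as
  Skolem functions are addressed by position only.
\<close>
lemma truth_alpha:
  fixes s :: "bool list \<Rightarrow> 'a list \<Rightarrow> 'd"
  assumes "alpha bs H H'" and "\<And>x y. same_var bs x y \<Longrightarrow> \<sigma> x = \<sigma>' y"
  shows "truth I \<phi> v T pos \<sigma> (\<lambda>r _. s r) H = truth I \<phi> v T pos \<sigma>' (\<lambda>r _. s r) H'"
  using assms
proof (induction bs H H' arbitrary: pos \<sigma> \<sigma>' s rule: alpha.induct)
  case (1 bs p ss r ts)
  have *: "val_tm \<phi> \<sigma> t = val_tm \<phi> \<sigma>' t'" if "alpha_tm bs t t'" for t t'
    using that 1(2)
  proof (induction bs t t' rule: alpha_tm.induct)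
    case (2 bs f us g us')
    then have "map (val_tm \<phi> \<sigma>) us = map (val_tm \<phi> \<sigma>') us'"
      by (auto simp: list_all2_conv_all_nth intro!: nth_equalityI)
    then show ?case using 2 by simp
  qed auto
  have "map (val_tm \<phi> \<sigma>) ss = map (val_tm \<phi> \<sigma>') ts"
    using 1(1) by (auto simp: list_all2_conv_all_nth intro!: nth_equalityI *)
  then show ?case using 1 by simp
next
  case (2 bs H H')
  then show ?case by simp
next
  case (3 bs H K H' K')
  then show ?case by simp
next
  case (4 bs H K H' K')
  then show ?case by simp
next
  case (5 bs q x H q' y H')
  have *: "truth I \<phi> v T pos (\<sigma>(x := d)) (\<lambda>r _. s' r) H
      = truth I \<phi> v T pos (\<sigma>'(y := d)) (\<lambda>r _. s' r) H'" for d s'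
    proof (rule 5(1))
    show "alpha ((x, y) # bs) H H'" using 5(2) by simp
    show "(\<sigma>(x := d)) a = (\<sigma>'(y := d)) b" if "same_var ((x, y) # bs) a b" for a b
      proof (cases "a = x \<or> b = y")
      case True
      then have "a = x" "b = y" using that by auto
      then show ?thesis by simp
    next
      case False
      then have "same_var bs a b" using that by simp
      from 5(3)[OF this] False show ?thesis by simp
    qed
  qed
  have "q = q'" using 5(2) by simp
  then show ?case
    unfolding truth.simps *[where s' = "\<lambda>r. s (False # r)"]
      *[where s' = "\<lambda>r as. s (False # r) (_ # as)"]
    by simp
qed simp_all

lemma val_tm_free [simp]: "val_tm Fun Var t = t"
  by (induction t) (auto simp: map_idI)

lemma truth_qfree:
  assumes "qfree H"
  shows "truth I \<phi> v T pos \<sigma> s H = sent_eval (\<lambda>p ts. I p (map (val_tm \<phi> \<sigma>) ts)) H"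
  using assms unfolding qfree_def by (induction H arbitrary: pos s) auto

section \<open>Derivations preserve validity below a rank\<close>
abbreviation truth_blind ::
  "('p \<Rightarrow> 'd list \<Rightarrow> bool) \<Rightarrow> ('f \<Rightarrow> 'd list \<Rightarrow> 'd) \<Rightarrow> 'd set \<Rightarrow> bool \<Rightarrow> (nat \<Rightarrow> 'd)
    \<Rightarrow> (bool list \<Rightarrow> 'd list \<Rightarrow> 'd) \<Rightarrow> ('f, 'p) fm \<Rightarrow> bool" where
  "truth_blind I \<phi> T pos \<sigma> s H \<equiv> truth I \<phi> (\<lambda>d. d) T pos \<sigma> (\<lambda>r _. s r) H"

lemma truth_variant:
  assumes "variant H H'"
  shows "truth_blind I \<phi> T pos \<sigma> s H = truth_blind I \<phi> T pos \<sigma> s H'"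
  using assms unfolding variant_def by (rule truth_alpha) simp

text \<open>
  Positions in \<open>C[H \<circ> H']\<close> are folded onto positions in \<open>C[H]\<close>: both copies of \<open>H\<close> go to the hole.
  Pulling Skolem functions back along this map makes the two copies agree.
\<close>
fun dup_path :: "('f, 'p) ctx \<Rightarrow> bool list \<Rightarrow> bool list" where
  "dup_path Hole r = tl r"
| "dup_path (CNeg C) r = dup_path C r"
| "dup_path (COrL C K) r = (case r of False # r' \<Rightarrow> False # dup_path C r' | _ \<Rightarrow> r)"
| "dup_path (COrR K C) r = (case r of True # r' \<Rightarrow> True # dup_path C r' | _ \<Rightarrow> r)"
| "dup_path (CAndL C K) r = (case r of False # r' \<Rightarrow> False # dup_path C r' | _ \<Rightarrow> r)"
| "dup_path (CAndR K C) r = (case r of True # r' \<Rightarrow> True # dup_path C r' | _ \<Rightarrow> r)"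
| "dup_path (CQt q x C) r = (case r of [] \<Rightarrow> [] | b # r' \<Rightarrow> b # dup_path C r')"

lemma truth_simplification:
  assumes "variant H H'"
  shows "truth_blind I \<phi> T pos \<sigma> (\<lambda>r. s (dup_path C r)) (fill C (doubled b H H'))
       = truth_blind I \<phi> T pos \<sigma> s (fill C H)"
proof (induction C arbitrary: pos \<sigma> s)
  case Hole
  show ?case using truth_variant[OF assms, of I \<phi> T pos \<sigma> s] by (simp add: doubled_def)
next
  case (CNeg C)
  then show ?case by simp
next
  case (COrL C K)
  show ?case using COrL[of pos \<sigma> "\<lambda>r. s (False # r)"] by simp
next
  case (COrR K C)
  show ?case using COrR[of pos \<sigma> "\<lambda>r. s (True # r)"] by simp
next
  case (CAndL C K)
  show ?case using CAndL[of pos \<sigma> "\<lambda>r. s (False # r)"] by simp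
next
  case (CAndR K C)
  show ?case using CAndR[of pos \<sigma> "\<lambda>r. s (True # r)"] by simp
next
  case (CQt q x C)
  show ?case
    using CQt[of pos _ "\<lambda>r. s (False # r)"] CQt[of pos _ "\<lambda>r as. s (False # r) (t # as)" for t]
    by (simp del: fun_upd_apply)
qed

fun branch :: "'b \<Rightarrow> (bool list \<Rightarrow> 'b) \<Rightarrow> (bool list \<Rightarrow> 'b) \<Rightarrow> bool list \<Rightarrow> 'b" where
  "branch u s0 s1 [] = u"
| "branch u s0 s1 (False # r) = s0 r"
| "branch u s0 s1 (True # r) = s1 r"

text \<open>
  \<open>G k\<close> plays the part of the terms of height at most \<open>k\<close>.
\<close>
definition ranked_skolem :: "(nat \<Rightarrow> 'd set) \<Rightarrow> (bool list \<Rightarrow> 'd list \<Rightarrow> 'd) \<Rightarrow> bool" where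
  "ranked_skolem G s \<longleftrightarrow> (\<forall>k r ds. set ds \<subseteq> G k \<longrightarrow> s r ds \<in> G (Suc k))"

lemma ranked_skolem_shift [simp]:
  "ranked_skolem G s \<Longrightarrow> ranked_skolem G (\<lambda>r. s (b # r))"
  by (simp add: ranked_skolem_def)

lemma ranked_skolem_branch:
  assumes "ranked_skolem G s" "ranked_skolem G s0"
  shows "ranked_skolem G (branch (s []) s0 (\<lambda>r. s (True # r)))"
    and "ranked_skolem G (branch (s []) (\<lambda>r. s (False # r)) s0)"
proof -
  have "branch (s []) s0 (\<lambda>r. s (True # r)) r ds \<in> G (Suc k)
      \<and> branch (s []) (\<lambda>r. s (False # r)) s0 r ds \<in> G (Suc k)" if "set ds \<subseteq> G k" for k r ds
    using that assms unfolding ranked_skolem_def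
    by (cases "(s [], s0, s0, r)" rule: branch.cases) auto
  then show "ranked_skolem G (branch (s []) s0 (\<lambda>r. s (True # r)))"
    "ranked_skolem G (branch (s []) (\<lambda>r. s (False # r)) s0)"
    unfolding ranked_skolem_def by blast+
qed

lemma ranked_skolem_raise:
  "ranked_skolem G s \<Longrightarrow> ranked_skolem (\<lambda>k. G (k + j)) s"
  by (auto simp: ranked_skolem_def)

text \<open>
  Skolem functions for the conclusion yield Skolem functions for the premise: those under the new
  \<open>\<gamma>\<close>-quantifier get the value \<open>d\<close> of \<open>t\<close> as their first argument. They respect only the
  filtration that is shifted by the rank \<open>j\<close> of \<open>d\<close>. The instance \<open>d\<close> then witnesses the
  conclusion, if the position is positive, and refutes it otherwise.
\<close>
lemma truth_gamma:
  assumes "variant H H'" and "fv_tm t \<inter> set (quantified H') = {}"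
    and "mono G" and d: "val_tm \<phi> \<sigma> t = d" "d \<in> G j" "d \<in> T"
    and "accessible C" "is_gamma (pos = positive C) q" "ranked_skolem G s"
  shows "\<exists>s'. ranked_skolem (\<lambda>k. G (k + j)) s' \<and>
    (if pos then truth_blind I \<phi> T pos \<sigma> s' (fill C (subst x t H'))
                \<longrightarrow> truth_blind I \<phi> T pos \<sigma> s (fill C (Qt q x H))
     else truth_blind I \<phi> T pos \<sigma> s (fill C (Qt q x H))
                \<longrightarrow> truth_blind I \<phi> T pos \<sigma> s' (fill C (subst x t H')))"
  using assms(7-)
proof (induction C arbitrary: pos s)
  case Hole
  \<comment> \<open>The new quantifier is a position of its own in the conclusion.\<close>
  let ?s = "\<lambda>r as. s (False # r) (d # as)"
  have "truth_blind I \<phi> T pos \<sigma> ?s (subst x t H') = truth_blind I \<phi> T pos (\<sigma>(x := d)) ?s H"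
    using truth_subst[OF assms(2)] truth_variant[OF assms(1)] d(1) by metis
  moreover have "ranked_skolem (\<lambda>k. G (k + j)) ?s"
    unfolding ranked_skolem_def
  proof (intro allI impI)
    fix k r ds
    assume "set ds \<subseteq> G (k + j)"
    moreover have "d \<in> G (k + j)" using d(2) monoD[OF assms(3), of j "k + j"] by auto
    ultimately show "s (False # r) (d # ds) \<in> G (Suc k + j)"
      using Hole(3) by (auto simp: ranked_skolem_def)
  qed
  ultimately show ?case
    using Hole(2) d(3) by (intro exI[of _ ?s]) (auto simp: is_gamma_def)
next
  case (CNeg C)
  then have "is_gamma ((\<not> pos) = positive C) q" by (cases pos) auto
  then show ?case using CNeg.IH[of "\<not> pos" s] CNeg.prems by (cases pos) auto
next
  case (COrL C K)
  obtain s0 where "ranked_skolem (\<lambda>k. G (k + j)) s0"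
    "if pos then truth_blind I \<phi> T pos \<sigma> s0 (fill C (subst x t H'))
                \<longrightarrow> truth_blind I \<phi> T pos \<sigma> (\<lambda>r. s (False # r)) (fill C (Qt q x H))
     else truth_blind I \<phi> T pos \<sigma> (\<lambda>r. s (False # r)) (fill C (Qt q x H))
                \<longrightarrow> truth_blind I \<phi> T pos \<sigma> s0 (fill C (subst x t H'))"
    using COrL.IH[of pos "\<lambda>r. s (False # r)"] COrL.prems by auto
  then show ?case using COrL.prems
    by (intro exI[of _ "branch (s []) s0 (\<lambda>r. s (True # r))"] conjI
        ranked_skolem_branch) (auto intro: ranked_skolem_raise)
next
  case (COrR K C)
  obtain s0 where "ranked_skolem (\<lambda>k. G (k + j)) s0"
    "if pos then truth_blind I \<phi> T pos \<sigma> s0 (fill C (subst x t H'))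
                \<longrightarrow> truth_blind I \<phi> T pos \<sigma> (\<lambda>r. s (True # r)) (fill C (Qt q x H))
     else truth_blind I \<phi> T pos \<sigma> (\<lambda>r. s (True # r)) (fill C (Qt q x H))
                \<longrightarrow> truth_blind I \<phi> T pos \<sigma> s0 (fill C (subst x t H'))"
    using COrR.IH[of pos "\<lambda>r. s (True # r)"] COrR.prems by auto
  then show ?case using COrR.prems
    by (intro exI[of _ "branch (s []) (\<lambda>r. s (False # r)) s0"] conjI
        ranked_skolem_branch) (auto intro: ranked_skolem_raise)
next
  case (CAndL C K)
  obtain s0 where "ranked_skolem (\<lambda>k. G (k + j)) s0"
    "if pos then truth_blind I \<phi> T pos \<sigma> s0 (fill C (subst x t H'))
                \<longrightarrow> truth_blind I \<phi> T pos \<sigma> (\<lambda>r. s (False # r)) (fill C (Qt q x H))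
     else truth_blind I \<phi> T pos \<sigma> (\<lambda>r. s (False # r)) (fill C (Qt q x H))
                \<longrightarrow> truth_blind I \<phi> T pos \<sigma> s0 (fill C (subst x t H'))"
    using CAndL.IH[of pos "\<lambda>r. s (False # r)"] CAndL.prems by auto
  then show ?case using CAndL.prems
    by (intro exI[of _ "branch (s []) s0 (\<lambda>r. s (True # r))"] conjI
        ranked_skolem_branch) (auto intro: ranked_skolem_raise)
next
  case (CAndR K C)
  obtain s0 where "ranked_skolem (\<lambda>k. G (k + j)) s0"
    "if pos then truth_blind I \<phi> T pos \<sigma> s0 (fill C (subst x t H'))
                \<longrightarrow> truth_blind I \<phi> T pos \<sigma> (\<lambda>r. s (True # r)) (fill C (Qt q x H))
     else truth_blind I \<phi> T pos \<sigma> (\<lambda>r. s (True # r)) (fill C (Qt q x H))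
                \<longrightarrow> truth_blind I \<phi> T pos \<sigma> s0 (fill C (subst x t H'))"
    using CAndR.IH[of pos "\<lambda>r. s (True # r)"] CAndR.prems by auto
  then show ?case using CAndR.prems
    by (intro exI[of _ "branch (s []) (\<lambda>r. s (False # r)) s0"] conjI
        ranked_skolem_branch) (auto intro: ranked_skolem_raise)
qed simp

text \<open>
  No \<open>\<gamma>\<close>-quantifier is above an accessible \<open>\<delta>\<close>-quantifier, so its Skolem function is a constant
  \<open>d\<close> of rank 1. Because \<open>z\<close> does not occur in the context, \<open>d\<close> can be assigned to it globally.
\<close>
lemma truth_delta:
  assumes "variant (Qt q y H) (Qt q z H')"
    and "accessible C" "\<not> is_gamma (pos = positive C) q" "z \<notin> fv_ctx C" "ranked_skolem G s"
  shows "\<exists>s' d. ranked_skolem G s' \<and> d \<in> G 1 \<and>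
    truth_blind I \<phi> T pos (\<sigma>(z := d)) s' (fill C H') = truth_blind I \<phi> T pos \<sigma> s (fill C (Qt q y H))"
  using assms(2-)
proof (induction C arbitrary: pos s)
  case Hole
  have "s [] [] \<in> G 1"
    using Hole(4) unfolding ranked_skolem_def by (metis One_nat_def empty_set empty_subsetI)
  moreover have "truth_blind I \<phi> T pos \<sigma> s (Qt q y H)
      = truth_blind I \<phi> T pos (\<sigma>(z := s [] [])) (\<lambda>r. s (False # r)) H'"
    using truth_variant[OF assms(1), of I \<phi> T pos \<sigma> s] Hole(2) by simp
  ultimately show ?case
    using Hole(4) Hole(2)
    by (intro exI[of _ "\<lambda>r. s (False # r)"] exI[of _ "s [] []"]) (simp del: fun_upd_apply)
next
  case (CNeg C)
  then have "\<not> is_gamma ((\<not> pos) = positive C) q" by (cases pos) auto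
  then show ?case using CNeg.IH[of "\<not> pos" s] CNeg.prems by auto
next
  case (COrL C K)
  obtain s0 d where "ranked_skolem G s0" "d \<in> G 1"
    "truth_blind I \<phi> T pos (\<sigma>(z := d)) s0 (fill C H')
       = truth_blind I \<phi> T pos \<sigma> (\<lambda>r. s (False # r)) (fill C (Qt q y H))"
    using COrL.IH[of pos "\<lambda>r. s (False # r)"] COrL.prems by (auto simp del: fun_upd_apply)
  moreover have "truth_blind I \<phi> T pos (\<sigma>(z := d)) s' K = truth_blind I \<phi> T pos \<sigma> s' K" for s'
    using COrL.prems by (intro truth_cong) auto
  ultimately show ?case using COrL.prems
    by (intro exI[of _ "branch (s []) s0 (\<lambda>r. s (True # r))"] exI[of _ d] conjI
        ranked_skolem_branch) (simp_all del: fun_upd_apply)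
next
  case (COrR K C)
  obtain s0 d where "ranked_skolem G s0" "d \<in> G 1"
    "truth_blind I \<phi> T pos (\<sigma>(z := d)) s0 (fill C H')
       = truth_blind I \<phi> T pos \<sigma> (\<lambda>r. s (True # r)) (fill C (Qt q y H))"
    using COrR.IH[of pos "\<lambda>r. s (True # r)"] COrR.prems by (auto simp del: fun_upd_apply)
  moreover have "truth_blind I \<phi> T pos (\<sigma>(z := d)) s' K = truth_blind I \<phi> T pos \<sigma> s' K" for s'
    using COrR.prems by (intro truth_cong) auto
  ultimately show ?case using COrR.prems
    by (intro exI[of _ "branch (s []) (\<lambda>r. s (False # r)) s0"] exI[of _ d] conjI
        ranked_skolem_branch) (simp_all del: fun_upd_apply)
next
  case (CAndL C K)
  obtain s0 d where "ranked_skolem G s0" "d \<in> G 1"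
    "truth_blind I \<phi> T pos (\<sigma>(z := d)) s0 (fill C H')
       = truth_blind I \<phi> T pos \<sigma> (\<lambda>r. s (False # r)) (fill C (Qt q y H))"
    using CAndL.IH[of pos "\<lambda>r. s (False # r)"] CAndL.prems by (auto simp del: fun_upd_apply)
  moreover have "truth_blind I \<phi> T pos (\<sigma>(z := d)) s' K = truth_blind I \<phi> T pos \<sigma> s' K" for s'
    using CAndL.prems by (intro truth_cong) auto
  ultimately show ?case using CAndL.prems
    by (intro exI[of _ "branch (s []) s0 (\<lambda>r. s (True # r))"] exI[of _ d] conjI
        ranked_skolem_branch) (simp_all del: fun_upd_apply)
next
  case (CAndR K C)
  obtain s0 d where "ranked_skolem G s0" "d \<in> G 1"
    "truth_blind I \<phi> T pos (\<sigma>(z := d)) s0 (fill C H')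
       = truth_blind I \<phi> T pos \<sigma> (\<lambda>r. s (True # r)) (fill C (Qt q y H))"
    using CAndR.IH[of pos "\<lambda>r. s (True # r)"] CAndR.prems by (auto simp del: fun_upd_apply)
  moreover have "truth_blind I \<phi> T pos (\<sigma>(z := d)) s' K = truth_blind I \<phi> T pos \<sigma> s' K" for s'
    using CAndR.prems by (intro truth_cong) auto
  ultimately show ?case using CAndR.prems
    by (intro exI[of _ "branch (s []) (\<lambda>r. s (False # r)) s0"] exI[of _ d] conjI
        ranked_skolem_branch) (simp_all del: fun_upd_apply)
qed simp

definition ranked ::
  "(nat \<Rightarrow> 'd set) \<Rightarrow> ('f \<Rightarrow> 'd list \<Rightarrow> 'd) \<Rightarrow> (nat \<Rightarrow> 'd) \<Rightarrow> (bool list \<Rightarrow> 'd list \<Rightarrow> 'd) \<Rightarrow> bool" where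
  "ranked G \<phi> \<sigma> s \<longleftrightarrow> mono G \<and> range \<sigma> \<subseteq> G 1 \<and>
     (\<forall>k f ds. set ds \<subseteq> G k \<longrightarrow> \<phi> f ds \<in> G (Suc k)) \<and> ranked_skolem G s"

lemma height_le_iff: "height (Fun f ts) \<le> Suc k \<longleftrightarrow> (\<forall>t\<in>set ts. height t \<le> k)"
  by (auto simp: Max_le_iff)

lemma height_pos: "0 < height t"
  by (cases t) auto

lemma val_tm_ranked:
  assumes "ranked G \<phi> \<sigma> s"
  shows "height t \<le> k \<Longrightarrow> val_tm \<phi> \<sigma> t \<in> G k"
proof (induction t arbitrary: k)
  case (Var x)
  have "\<sigma> x \<in> G 1" using assms by (auto simp: ranked_def)
  moreover have "G 1 \<subseteq> G k"
    using assms Var by (simp add: ranked_def monoD)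
  ultimately show ?case by auto
next
  case (Fun f ts)
  then obtain k' where k: "k = Suc k'" by (cases k) auto
  have "set (map (val_tm \<phi> \<sigma>) ts) \<subseteq> G k'"
    using Fun k height_le_iff[of f ts k'] by auto
  then show ?case using assms k by (simp add: ranked_def)
qed

text \<open>
  The algebras are taken over the carrier of extended terms because a definition cannot quantify
  over types, and this carrier is the one to which validity is finally applied.
\<close>
definition valid_below :: "nat \<Rightarrow> ('f, 'p) fm \<Rightarrow> bool" where
  "valid_below m K \<longleftrightarrow>
     (\<forall>(I :: 'p \<Rightarrow> 'f ext tm list \<Rightarrow> bool) \<phi> \<sigma> s G.
        ranked G \<phi> \<sigma> s \<longrightarrow> truth_blind I \<phi> (G m) True \<sigma> s K)"

fun rule_height :: "'f rule \<Rightarrow> nat" where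
  "rule_height (Gamma t) = height t"
| "rule_height _ = 0"

text \<open>
  This is the only place where the order changes: validity of the premise is used for the filtration
  shifted by the height of the \<open>\<gamma>\<close>-instance, whose stage \<open>m\<close> is the stage \<open>m + |t|\<close> of the given one.
\<close>
lemma infer_valid_below:
  fixes P K :: "('f, 'p) fm"
  assumes "infer r P K" "valid_below m P"
  shows "valid_below (m + rule_height r) K"
  unfolding valid_below_def
proof (intro allI impI)
  fix I :: "'p \<Rightarrow> 'f ext tm list \<Rightarrow> bool"
    and \<phi> :: "'f \<Rightarrow> 'f ext tm list \<Rightarrow> 'f ext tm" and \<sigma> s G
  assume rk: "ranked G \<phi> \<sigma> s"
  have P: "truth_blind I \<phi> (G' m) True \<sigma>' s' P" if "ranked G' \<phi> \<sigma>' s'" for \<sigma>' s' G'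
    using that assms(2) unfolding valid_below_def by blast
  from assms(1) show "truth_blind I \<phi> (G (m + rule_height r)) True \<sigma> s K"
  proof (cases rule: infer.cases)
    case (simplification H H' C)
    have "ranked G \<phi> \<sigma> (\<lambda>r. s (dup_path C r))"
      using rk by (auto simp: ranked_def ranked_skolem_def)
    from P[OF this] truth_simplification[OF simplification(4), of I \<phi> "G m" True \<sigma> s C "positive C"]
    show ?thesis using simplification by simp
  next
    case (gamma C q H H' t x)
    have d: "val_tm \<phi> \<sigma> t \<in> G (height t)" "val_tm \<phi> \<sigma> t \<in> G (m + height t)"
      using val_tm_ranked[OF rk] by auto
    obtain s' where s': "ranked_skolem (\<lambda>k. G (k + height t)) s'"
      "truth_blind I \<phi> (G (m + height t)) True \<sigma> s' P
        \<longrightarrow> truth_blind I \<phi> (G (m + height t)) True \<sigma> s K"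
      using truth_gamma[where G = G and j = "height t",
          OF gamma(6,7) _ refl d gamma(4), of True q s I x] gamma rk
      by (auto simp: ranked_def)
    have "G k \<subseteq> G (k + height t)" for k using rk by (simp add: ranked_def monoD)
    then have "ranked (\<lambda>k. G (k + height t)) \<phi> \<sigma> s'"
      unfolding ranked_def
    proof (intro conjI allI impI)
      show "mono (\<lambda>k. G (k + height t))" using rk by (simp add: ranked_def mono_def)
      show "range \<sigma> \<subseteq> G (1 + height t)" using rk \<open>\<And>k. G k \<subseteq> G (k + height t)\<close>[of 1]
        unfolding ranked_def by auto
    qed (use rk s'(1) in \<open>simp_all add: ranked_def\<close>)
    from P[OF this] s'(2) show ?thesis using gamma by simp
  next
    case (delta C q y H z H')
    obtain s' d where s': "ranked_skolem G s'" "d \<in> G 1"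
      "truth_blind I \<phi> (G m) True (\<sigma>(z := d)) s' P = truth_blind I \<phi> (G m) True \<sigma> s K"
      using truth_delta[where G = G and s = s and pos = True and \<sigma> = \<sigma> and I = I and T = "G m" and \<phi> = \<phi>,
          OF delta(6,4)] delta rk
      by (auto simp: ranked_def simp del: fun_upd_apply)
    then have "ranked G \<phi> (\<sigma>(z := d)) s'" using rk by (auto simp: ranked_def)
    from P[OF this] s'(3) show ?thesis using delta by simp
  next
    case renaming
    from P[OF rk] show ?thesis
      using renaming(1) iffD1[OF truth_variant[OF renaming(2)]] by simp
  qed
qed

lemma derivation_valid_below:
  assumes "derivation B D A" "valid_below m B"
  shows "valid_below (m + sum_list (map (\<lambda>(r, K). rule_height r) D)) A"
  using assms
proof (induction B D A arbitrary: m rule: derivation.induct)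
  case (2 B r K D A)
  then show ?case using infer_valid_below[of r B K m] 2(1)[of "m + rule_height r"]
    by (simp add: add.assoc)
qed simp

text \<open>
  Validity below \<open>0\<close>, where there are no instances, is where the order of a derivation starts.
\<close>
lemma tautology_valid_below:
  fixes B :: "('f, 'p) fm"
  assumes "sentential_tautology B"
  shows "valid_below m B"
  unfolding valid_below_def
proof (intro allI impI)
  fix I :: "'p \<Rightarrow> 'f ext tm list \<Rightarrow> bool"
    and \<phi> :: "'f \<Rightarrow> 'f ext tm list \<Rightarrow> 'f ext tm" and \<sigma> s G
  show "truth_blind I \<phi> (G m) True \<sigma> s B"
    using assms by (simp add: truth_qfree sentential_tautology_def)
qed

text \<open>
  The expansion with \<open>\<T>\<^sub>1\<close> is defined only for quantifier-free formulas. Validity below \<open>0\<close> does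
  not ensure this, as it takes empty disjunctions to be false, so the absence of
  \<open>\<gamma>\<close>-quantifiers is tracked separately: a derivation of total height \<open>0\<close> never introduces one.
\<close>
fun gamma_free :: "bool \<Rightarrow> ('f, 'p) fm \<Rightarrow> bool" where
  "gamma_free pos (Atom p ts) = True"
| "gamma_free pos (Neg H) = gamma_free (\<not> pos) H"
| "gamma_free pos (Or H K) = (gamma_free pos H \<and> gamma_free pos K)"
| "gamma_free pos (And H K) = (gamma_free pos H \<and> gamma_free pos K)"
| "gamma_free pos (Qt q x H) = (\<not> is_gamma pos q \<and> gamma_free pos H)"

lemma gamma_free_alpha: "alpha bs H H' \<Longrightarrow> gamma_free pos H = gamma_free pos H'"
  by (induction bs H H' arbitrary: pos rule: alpha.induct) auto

lemma gamma_free_fill: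
  assumes "gamma_free (pos = positive C) H \<longrightarrow> gamma_free (pos = positive C) K"
    and "gamma_free pos (fill C H)"
  shows "gamma_free pos (fill C K)"
  using assms
proof (induction C arbitrary: pos)
  case (CNeg C)
  have "(\<not> pos) = positive C \<longleftrightarrow> pos = (\<not> positive C)" by auto
  then show ?case using CNeg.IH[of "\<not> pos"] CNeg.prems by simp
qed auto

lemma infer_gamma_free:
  assumes "infer r P K" "rule_height r = 0" "gamma_free True P"
  shows "gamma_free True K"
  using assms(1)
proof (cases rule: infer.cases)
  case (simplification H H' C)
  then show ?thesis using assms(3)
    by (auto intro!: gamma_free_fill[of True C "doubled (positive C) H H'" H] simp: doubled_def split: if_splits)
next
  case (gamma C q H H' t x)
  then show ?thesis using assms(2) height_pos[of t] by simp
next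
  case (delta C q y H z H')
  then show ?thesis
    using assms(3) gamma_free_alpha[of "[]" "Qt q y H" "Qt q z H'" "positive C"]
    by (auto intro!: gamma_free_fill[of True C H' "Qt q y H"] simp: variant_def)
next
  case renaming
  then show ?thesis using assms(3) gamma_free_alpha[of "[]" P K True] by (simp add: variant_def)
qed

lemma derivation_gamma_free:
  assumes "derivation B D A" "gamma_free True B"
    "sum_list (map (\<lambda>(r, K). rule_height r) D) = 0"
  shows "gamma_free True A"
  using assms by (induction B D A rule: derivation.induct) (auto dest: infer_gamma_free)

section \<open>Property C as truth under free Skolem functions\<close>
lemma quantified_subst [simp]: "quantified (subst x t H) = quantified H"
  by (induction H) auto

lemma fv_subst_tm: "fv_tm (subst_tm x t u) = (if x \<in> fv_tm u then fv_tm u - {x} \<union> fv_tm t else fv_tm u)"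
  by (induction u) (auto split: if_splits)

lemma fv_subst:
  assumes "fv_tm t \<inter> set (quantified H) = {}"
  shows "fv (subst x t H) = (if x \<in> fv H then fv H - {x} \<union> fv_tm t else fv H)"
  using assms
proof (induction H)
  case (Or H K)
  show ?case using Or.IH Or.prems by (auto simp: Int_Un_distrib)
next
  case (And H K)
  show ?case using And.IH And.prems by (auto simp: Int_Un_distrib)
qed (auto simp: fv_subst_tm split: if_splits)

lemma syms_subst_tm:
  "set (syms_tm (subst_tm x t u)) = set (syms_tm u) \<union> (if x \<in> fv_tm u then set (syms_tm t) else {})"
  by (induction u) (auto split: if_splits)

lemma syms_subst:
  "set (syms (subst x t H)) = set (syms H) \<union> (if x \<in> fv H then set (syms_tm t) else {})"
  by (induction H) (auto simp: syms_subst_tm split: if_splits)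

lemma no_vacuous_subst:
  assumes "fv_tm t \<inter> set (quantified H) = {}"
  shows "no_vacuous (subst x t H) = no_vacuous H"
  using assms
proof (induction H)
  case (Qt q y H)
  then show ?case by (auto simp: fv_subst)
qed (auto simp: Int_Un_distrib)

definition lift :: "('f, 'p) fm \<Rightarrow> ('f ext, 'p) fm" where
  "lift = map_fm Sym id"

lemma lift_simps [simp]:
  "lift (Atom p ts) = Atom p (map (map_tm Sym) ts)"
  "lift (Neg H) = Neg (lift H)"
  "lift (Or H K) = Or (lift H) (lift K)"
  "lift (And H K) = And (lift H) (lift K)"
  "lift (Qt q x H) = Qt q x (lift H)"
  by (simp_all add: lift_def)

lemma fv_lift_tm [simp]: "fv_tm (map_tm Sym t) = fv_tm t"
  by (induction t) auto

lemma syms_lift_tm [simp]: "set (syms_tm (map_tm Sym t)) = (\<lambda>(f, m). (Sym f, m)) ` set (syms_tm t)"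
  by (induction t) (auto simp: image_UN)

lemma val_tm_lift [simp]: "val_tm Fun \<sigma> (map_tm Sym t) = val_tm (\<lambda>f. Fun (Sym f)) \<sigma> t"
  by (induction t) auto

fun gamma_only :: "bool \<Rightarrow> ('f, 'p) fm \<Rightarrow> bool" where
  "gamma_only pos (Atom p ts) = True"
| "gamma_only pos (Neg H) = gamma_only (\<not> pos) H"
| "gamma_only pos (Or H K) = (gamma_only pos H \<and> gamma_only pos K)"
| "gamma_only pos (And H K) = (gamma_only pos H \<and> gamma_only pos K)"
| "gamma_only pos (Qt q x H) = (is_gamma pos q \<and> gamma_only pos H)"

lemma gamma_only_subst [simp]: "gamma_only pos (subst x t H) = gamma_only pos H"
  by (induction H arbitrary: pos) auto

lemma gamma_only_skolemize: "gamma_only pos (skolemize pos xs H)"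
  by (induction H arbitrary: pos xs) auto

lemma quantified_skolemize_subset: "set (quantified (skolemize pos xs H)) \<subseteq> set (quantified H)"
  by (induction H arbitrary: pos xs) (auto, blast+)

lemma distinct_quantified_skolemize:
  "distinct (quantified H) \<Longrightarrow> distinct (quantified (skolemize pos xs H))"
proof (induction H arbitrary: pos xs)
  case (Or H K)
  then show ?case using quantified_skolemize_subset[of pos xs H] quantified_skolemize_subset[of pos xs K]
    by auto
next
  case (And H K)
  then show ?case using quantified_skolemize_subset[of pos xs H] quantified_skolemize_subset[of pos xs K]
    by auto
next
  case (Qt q x H)
  then show ?case using quantified_skolemize_subset[of pos "xs @ [x]" H] by auto
qed auto

lemma qfree_skolemize: "qfree (skolemize pos xs H) \<longleftrightarrow> gamma_free pos H"
  by (induction H arbitrary: pos xs) (auto simp: qfree_def)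

lemma fv_skolemize:
  assumes "distinct (quantified H)" "set xs \<inter> set (quantified H) = {}"
  shows "fv H \<subseteq> fv (skolemize pos xs H) \<and> fv (skolemize pos xs H) \<subseteq> fv H \<union> set xs"
  using assms
proof (induction H arbitrary: pos xs)
  case (Neg H)
  then show ?case by simp
next
  case (Or H K)
  show ?case using Or.IH(1)[of xs pos] Or.IH(2)[of xs pos] Or.prems by (auto simp: Int_Un_distrib)
next
  case (And H K)
  show ?case using And.IH(1)[of xs pos] And.IH(2)[of xs pos] And.prems by (auto simp: Int_Un_distrib)
next
  case (Qt q x H)
  have "set xs \<inter> set (quantified (skolemize pos xs H)) = {}"
    using quantified_skolemize_subset[of pos xs H] Qt.prems by auto
  then show ?case
    using Qt.IH[of xs pos] Qt.IH[of "xs @ [x]" pos] Qt.prems by (auto simp: fv_subst)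
qed auto

lemma no_vacuous_skolemize:
  assumes "no_vacuous H" "distinct (quantified H)" "set xs \<inter> set (quantified H) = {}"
  shows "no_vacuous (skolemize pos xs H)"
  using assms
proof (induction H arbitrary: pos xs)
  case (Qt q x H)
  have "set xs \<inter> set (quantified (skolemize pos xs H)) = {}"
    using quantified_skolemize_subset[of pos xs H] Qt.prems by auto
  then show ?case
    using Qt.IH[of xs pos] Qt.IH[of "xs @ [x]" pos] Qt.prems fv_skolemize[of H "xs @ [x]" pos]
    by (auto simp: no_vacuous_subst)
qed (auto simp: Int_Un_distrib)

lemma syms_skolemize:
  assumes "no_vacuous H" "distinct (quantified H)" "set xs \<inter> set (quantified H) = {}"
  shows "set (syms (skolemize pos xs H))
       = set (syms H) \<union> (\<lambda>(y, m). (Sko y, length xs + m)) ` set (skolems pos H)"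
  using assms
proof (induction H arbitrary: pos xs)
  case (Neg H)
  then show ?case by simp
next
  case (Or H K)
  then show ?case by (simp add: Int_Un_distrib image_Un Un_ac)
next
  case (And H K)
  then show ?case by (simp add: Int_Un_distrib image_Un Un_ac)
next
  case (Qt q x H)
  show ?case
  proof (cases "is_gamma pos q")
    case True
    then show ?thesis using Qt.IH[of "xs @ [x]" pos] Qt.prems
      by (simp add: image_image case_prod_unfold)
  next
    case False
    have "x \<in> fv (skolemize pos xs H)"
      using Qt.prems fv_skolemize[of H xs pos] by auto
    then show ?thesis using False Qt.IH[of xs pos] Qt.prems by (auto simp: syms_subst)
  qed
qed auto

lemma fv_lift [simp]: "fv (lift H) = fv H"
  by (induction H) auto

lemma quantified_lift [simp]: "quantified (lift H) = quantified H"
  by (induction H) auto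

lemma no_vacuous_lift [simp]: "no_vacuous (lift H) = no_vacuous H"
  by (induction H) auto

lemma skolems_lift [simp]: "skolems pos (lift H) = skolems pos H"
  by (induction H arbitrary: pos) auto

lemma gamma_free_lift [simp]: "gamma_free pos (lift H) = gamma_free pos H"
  by (induction H arbitrary: pos) auto

lemma syms_lift [simp]: "set (syms (lift H)) = (\<lambda>(f, m). (Sym f, m)) ` set (syms H)"
  by (induction H) (auto simp: image_UN image_Un)

lemma outer_skolemized_lift: "outer_skolemized A = skolemize True [] (lift A)"
  by (simp add: outer_skolemized_def lift_def)

text \<open>
  Since no quantifier is vacuous, every Skolem symbol occurs in the Skolemized form and hence is
  available for building the terms of the expansion.
\<close>
lemma rectified_outer_skolemized:
  assumes "rectified A"
  shows "rectified (outer_skolemized A)" "fv (outer_skolemized A) = fv A"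
    "set (quantified (outer_skolemized A)) \<subseteq> set (quantified A)"
    "set (syms (outer_skolemized A))
       = (\<lambda>(f, m). (Sym f, m)) ` set (syms A) \<union> (\<lambda>(y, m). (Sko y, m)) ` set (skolems True A)"
proof -
  have A: "no_vacuous (lift A)" "distinct (quantified (lift A))"
    using assms by (auto simp: rectified_def)
  show fv: "fv (outer_skolemized A) = fv A"
    using fv_skolemize[of "lift A" "[]" True] A unfolding outer_skolemized_lift by auto
  show q: "set (quantified (outer_skolemized A)) \<subseteq> set (quantified A)"
    using quantified_skolemize_subset[of True "[]" "lift A"] unfolding outer_skolemized_lift by simp
  show "rectified (outer_skolemized A)"
    unfolding rectified_def
    using assms no_vacuous_skolemize[of "lift A" "[]" True] A fv q
      distinct_quantified_skolemize[of "lift A" True "[]"]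
    by (auto simp: rectified_def outer_skolemized_lift)
  show "set (syms (outer_skolemized A))
       = (\<lambda>(f, m). (Sym f, m)) ` set (syms A) \<union> (\<lambda>(y, m). (Sko y, m)) ` set (skolems True A)"
    using syms_skolemize[of "lift A" "[]" True] A unfolding outer_skolemized_lift
    by simp
qed

text \<open>
  Skolem terms have the list \<open>xs\<close> of the variables above them as arguments; under an assignment they
  become the list of the instances, as \<open>truth\<close> has it. The variables are pairwise different, so a
  later assignment does not overwrite an earlier one. The Skolemized formula has no
  \<open>\<delta>\<close>-quantifiers, so its own Skolem functions \<open>s\<close> are arbitrary.
\<close>
lemma truth_skolemize:
  assumes "distinct (quantified H)" "set xs \<inter> set (quantified H) = {}"
  shows "truth I Fun (\<lambda>t. t) T pos \<sigma> s (skolemize pos xs (lift H))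
    = truth I (\<lambda>f. Fun (Sym f)) (\<lambda>t. t) T pos \<sigma> (\<lambda>r y ts. Fun (Sko y) (map \<sigma> xs @ ts)) H"
  using assms
proof (induction H arbitrary: pos xs \<sigma> s)
  case (Qt q x H)
  have xs: "map (\<sigma>(x := d)) xs = map \<sigma> xs" for d
    using Qt.prems by (auto simp: fun_upd_def)
  show ?case
  proof (cases "is_gamma pos q")
    case True
    have "truth I Fun (\<lambda>t. t) T pos (\<sigma>(x := t)) s' (skolemize pos (xs @ [x]) (lift H))
      = truth I (\<lambda>f. Fun (Sym f)) (\<lambda>t. t) T pos (\<sigma>(x := t))
          (\<lambda>r y ts. Fun (Sko y) (map \<sigma> xs @ t # ts)) H" for t s'
      using Qt.prems xs by (subst Qt.IH) (auto simp del: fun_upd_apply simp add: fun_upd_same)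
    then show ?thesis using True by (simp del: fun_upd_apply)
  next
    case False
    let ?u = "Fun (Sko x) (map \<sigma> xs)"
    have "val_tm Fun \<sigma> (Fun (Sko x) (map Var xs)) = ?u" by (simp add: comp_def)
    moreover have "set xs \<inter> set (quantified (skolemize pos xs (lift H))) = {}"
      using quantified_skolemize_subset[of pos xs "lift H"] Qt.prems by auto
    ultimately have "truth I Fun (\<lambda>t. t) T pos \<sigma> s
          (subst x (Fun (Sko x) (map Var xs)) (skolemize pos xs (lift H)))
        = truth I Fun (\<lambda>t. t) T pos (\<sigma>(x := ?u)) s (skolemize pos xs (lift H))"
      by (subst truth_subst) (auto simp del: fun_upd_apply val_tm.simps)
    also have "\<dots> = truth I (\<lambda>f. Fun (Sym f)) (\<lambda>t. t) T pos (\<sigma>(x := ?u))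
          (\<lambda>r y ts. Fun (Sko y) (map \<sigma> xs @ ts)) H"
      using Qt.prems by (subst Qt.IH) (auto simp: xs simp del: fun_upd_apply)
    finally show ?thesis using False by (simp del: fun_upd_apply)
  qed
qed (auto simp: comp_def Int_Un_distrib)

lemma qfree_subst [simp]: "qfree (subst x t H) = qfree H"
  by (simp add: qfree_def)

lemma sent_eval_junction:
  "Ks \<noteq> [] \<Longrightarrow> sent_eval J (junction q Ks) =
     (if q = Exists then \<exists>K\<in>set Ks. sent_eval J K else \<forall>K\<in>set Ks. sent_eval J K)"
  by (induction q Ks rule: junction.induct) (auto split: quant.split)

lemma qfree_junction: "Ks \<noteq> [] \<Longrightarrow> qfree (junction q Ks) = (\<forall>K\<in>set Ks. qfree K)"
  by (induction q Ks rule: junction.induct) (auto simp: qfree_def split: quant.split)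

lemma qfree_expand: "ts \<noteq> [] \<or> qfree F \<Longrightarrow> qfree (expand ts F)"
proof (induction F)
  case (Qt q x F)
  then show ?case by (auto simp: qfree_junction) (simp_all add: qfree_def)
qed (auto simp: qfree_def)

text \<open>
  The instances contain no bound variable, so instantiating from the inside out, as the expansion
  does, agrees with assigning values from the outside in.
\<close>
lemma sent_eval_expand:
  assumes "gamma_only pos F" "ts \<noteq> [] \<or> qfree F"
    and "\<And>t. t \<in> set ts \<Longrightarrow> fv_tm t \<inter> set (quantified F) = {}"
    and "\<And>t. t \<in> set ts \<Longrightarrow> val_tm Fun \<sigma> t = t"
  shows "sent_eval (\<lambda>p us. I p (map (val_tm Fun \<sigma>) us)) (expand ts F)
       = truth I Fun (\<lambda>t. t) (set ts) pos \<sigma> s F"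
  using assms
proof (induction F arbitrary: pos \<sigma> s)
  case (Qt q x F)
  have ts: "ts \<noteq> []" using Qt.prems(2) by (auto simp: qfree_def)
  have "sent_eval (\<lambda>p us. I p (map (val_tm Fun \<sigma>) us)) (subst x t (expand ts F))
      = truth I Fun (\<lambda>t. t) (set ts) pos (\<sigma>(x := t)) s' F" if t: "t \<in> set ts" for t s'
  proof -
    have E: "qfree (expand ts F)" using ts by (simp add: qfree_expand)
    have "sent_eval (\<lambda>p us. I p (map (val_tm Fun \<sigma>) us)) (subst x t (expand ts F))
        = truth I Fun (\<lambda>t. t) {} pos \<sigma> s' (subst x t (expand ts F))"
      using E by (simp add: truth_qfree)
    also have "\<dots> = truth I Fun (\<lambda>t. t) {} pos (\<sigma>(x := t)) s' (expand ts F)"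
      using E Qt.prems(4)[OF t] by (subst truth_subst) (simp_all add: qfree_def)
    also have "\<dots> = sent_eval (\<lambda>p us. I p (map (val_tm Fun (\<sigma>(x := t))) us)) (expand ts F)"
      using E by (simp add: truth_qfree)
    also have "\<dots> = truth I Fun (\<lambda>t. t) (set ts) pos (\<sigma>(x := t)) s' F"
    proof (rule Qt.IH)
      fix u assume u: "u \<in> set ts"
      show "fv_tm u \<inter> set (quantified F) = {}" using Qt.prems(3)[OF u] by simp
      have "val_tm Fun (\<sigma>(x := t)) u = val_tm Fun \<sigma> u"
        by (rule val_tm_hom[of u "\<lambda>d. d"]) (use Qt.prems(3)[OF u] in auto)
      then show "val_tm Fun (\<sigma>(x := t)) u = u" using Qt.prems(4)[OF u] by simp
    qed (use Qt.prems ts in auto)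
    finally show ?thesis .
  qed
  then show ?case using Qt.prems(1) ts by (simp add: sent_eval_junction del: fun_upd_apply)
next
  case (Neg F)
  then show ?case by (simp add: qfree_def)
next
  case (Or F K)
  then show ?case by (auto simp: qfree_def Int_Un_distrib)
next
  case (And F K)
  then show ?case by (auto simp: qfree_def Int_Un_distrib)
qed simp

text \<open>
  In particular \<open>\<T>\<^sub>n(F)\<close> is finite.
\<close>
lemma set_term_list:
  "set (term_list vs fs k) = {t. height t \<le> k \<and> set (syms_tm t) \<subseteq> set fs \<and> fv_tm t \<subseteq> set vs}"
proof (induction k)
  case 0
  have "\<not> height t \<le> 0" for t :: "'a tm" using height_pos[of t] by simp
  then show ?case by auto
next
  case (Suc k)
  show ?case
  proof (intro set_eqI)
    fix t
    show "t \<in> set (term_list vs fs (Suc k)) \<longleftrightarrow>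
      t \<in> {t. height t \<le> Suc k \<and> set (syms_tm t) \<subseteq> set fs \<and> fv_tm t \<subseteq> set vs}"
    proof (cases t)
      case (Fun f ts)
      have "t \<in> set (term_list vs fs (Suc k)) \<longleftrightarrow>
          (f, length ts) \<in> set fs \<and> set ts \<subseteq> set (term_list vs fs k)"
        using Fun by (force simp: set_n_lists)
      then show ?thesis unfolding Fun mem_Collect_eq height_le_iff Suc by auto
    qed auto
  qed
qed

lemma finite_fv_tm: "finite (fv_tm t)"
  by (induction t) auto

lemma finite_fv: "finite (fv H)"
  by (induction H) (auto simp: finite_fv_tm)

lemma terms_below_term_list:
  "terms_below n F = set (term_list (sorted_list_of_set (fv F)) (term_syms F) (n - 1))"
proof -
  have "height t < n \<longleftrightarrow> height t \<le> n - 1" for t :: "'a ext tm"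
    using height_pos[of t] by linarith
  then show ?thesis by (auto simp: terms_below_def set_term_list finite_fv)
qed

abbreviation skolem_truth ::
  "('p \<Rightarrow> 'f ext tm list \<Rightarrow> bool) \<Rightarrow> 'f ext tm set \<Rightarrow> ('f, 'p) fm \<Rightarrow> bool" where
  "skolem_truth I T \<equiv>
     truth I (\<lambda>f. Fun (Sym f)) (\<lambda>t. t) T True Var (\<lambda>r y ts. Fun (Sko y) ts)"

lemma property_C_truth:
  assumes "rectified A"
  shows "property_C n A \<longleftrightarrow>
    (terms_below n (outer_skolemized A) = {} \<longrightarrow> gamma_free True A) \<and>
    (\<forall>I. skolem_truth I (terms_below n (outer_skolemized A)) A)"
proof -
  let ?F = "outer_skolemized A"
  let ?T = "terms_below n ?F"
  let ?ts = "SOME ts. distinct ts \<and> set ts = ?T"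
  have ts: "set ?ts = ?T"
  proof -
    have "\<exists>ts. distinct ts \<and> set ts = ?T"
      using finite_distinct_list[of ?T] unfolding terms_below_term_list by blast
    from someI_ex[OF this] show ?thesis ..
  qed
  have qf: "qfree ?F \<longleftrightarrow> gamma_free True A"
    by (simp add: outer_skolemized_lift qfree_skolemize)
  have fv: "fv_tm t \<inter> set (quantified ?F) = {}" if "t \<in> ?T" for t
    using that assms rectified_outer_skolemized[OF assms]
    by (auto simp: terms_below_def rectified_def)
  have defd: "expansion_defined ?T ?F \<longleftrightarrow> (?T = {} \<longrightarrow> gamma_free True A)"
    using fv qf rectified_outer_skolemized(1)[OF assms]
    by (auto simp: expansion_defined_def terms_below_term_list)
  have "sentential_tautology (expansion ?T ?F) \<longleftrightarrow> (\<forall>I. skolem_truth I ?T A)"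
    if D: "?T = {} \<longrightarrow> gamma_free True A"
  proof -
    have ne: "?ts \<noteq> [] \<or> qfree ?F" using D ts qf by force
    have "sent_eval I (expand ?ts ?F) = skolem_truth I ?T A" for I
    proof -
      have "sent_eval (\<lambda>p us. I p (map (val_tm Fun Var) us)) (expand ?ts ?F)
          = truth I Fun (\<lambda>t. t) (set ?ts) True Var (\<lambda>_ _ _. undefined) ?F"
        using ne fv ts
        by (intro sent_eval_expand) (auto simp: outer_skolemized_lift gamma_only_skolemize)
      also have "\<dots> = skolem_truth I ?T A"
        unfolding outer_skolemized_lift ts[unfolded outer_skolemized_lift]
        using assms by (subst truth_skolemize) (auto simp: rectified_def)
      finally show ?thesis by (simp add: map_idI)
    qed
    then show ?thesis
      using qfree_expand[OF ne] by (auto simp: sentential_tautology_def expansion_def)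
  qed
  then show ?thesis unfolding property_C_def Let_def defd by blast
qed

text \<open>
  The variable of the quantifier at a position, and \<open>0\<close> if there is none. It turns Skolem functions
  that are addressed by name into ones that are addressed by position.
\<close>
fun binder_at :: "('f, 'p) fm \<Rightarrow> bool list \<Rightarrow> nat" where
  "binder_at (Neg H) r = binder_at H r"
| "binder_at (Or H K) r = (case r of [] \<Rightarrow> 0 | b # r' \<Rightarrow> binder_at (if b then K else H) r')"
| "binder_at (And H K) r = (case r of [] \<Rightarrow> 0 | b # r' \<Rightarrow> binder_at (if b then K else H) r')"
| "binder_at (Qt q x H) r = (case r of [] \<Rightarrow> x | b # r' \<Rightarrow> binder_at H r')"
| "binder_at (Atom p ts) r = 0"

lemma truth_binder_at:
  "truth I \<phi> v T pos \<sigma> (\<lambda>r _. s r (binder_at H r)) H = truth I \<phi> v T pos \<sigma> (\<lambda>r. s r) H"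
proof (induction H arbitrary: pos \<sigma> s)
  case (Or H K)
  show ?case using Or(1)[of _ _ "\<lambda>r. s (False # r)"] Or(2)[of _ _ "\<lambda>r. s (True # r)"] by simp
next
  case (And H K)
  show ?case using And(1)[of _ _ "\<lambda>r. s (False # r)"] And(2)[of _ _ "\<lambda>r. s (True # r)"] by simp
next
  case (Qt q x H)
  show ?case
    using Qt[of _ _ "\<lambda>r. s (False # r)"] Qt[of _ _ "\<lambda>r y as. s (False # r) y (t # as)" for t]
    by (simp del: fun_upd_apply)
qed auto

text \<open>
  The algebra is the set of all terms over the signature of the Skolemized form, filtered by height.
  Function symbols, variables and Skolem symbols foreign to it are interpreted by some fixed term
  \<open>c\<close> of height 1. This absorbs the symbols that occur in a derivation but not in its conclusion.
\<close>
lemma valid_below_property_C: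
  fixes A :: "('f, 'p) fm"
  assumes A: "rectified A" and v: "valid_below m A" and gf: "m = 0 \<longrightarrow> gamma_free True A"
  shows "property_C (Suc m) A"
proof -
  let ?F = "outer_skolemized A"
  define G where "G k = terms_below (Suc k) ?F" for k
  have G: "t \<in> G k \<longleftrightarrow> height t \<le> k \<and> set (syms_tm t) \<subseteq> set (term_syms ?F) \<and> fv_tm t \<subseteq> fv ?F" for t k
    by (auto simp: G_def terms_below_def)
  \<comment> \<open>The constant \<open>Bullet\<close> takes care of signatures without constants and free variables.\<close>
  have "\<exists>c. c \<in> G 1"
  proof (cases "fv ?F = {}")
    case False
    then obtain x where "x \<in> fv ?F" by auto
    then have "Var x \<in> G 1" by (simp add: G)
    then show ?thesis ..
  next
    case True
    have "\<exists>f. (f, 0) \<in> set (term_syms ?F)"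
    proof (cases "\<forall>(f, m)\<in>set (syms ?F). m \<noteq> 0")
      case False
      then show ?thesis by (auto simp: term_syms_def)
    next
      case no_const: True
      then have "term_syms ?F = remdups (syms ?F) @ [(Bullet, 0)]"
        using True by (simp add: term_syms_def)
      then show ?thesis by auto
    qed
    then obtain f where "(f, 0) \<in> set (term_syms ?F)" ..
    then have "Fun f [] \<in> G 1" by (simp add: G)
    then show ?thesis ..
  qed
  then obtain c where c: "c \<in> G 1" ..
  have mono: "mono G" by (auto simp: mono_def G)
  have cG: "c \<in> G (Suc k)" for k using c monoD[OF mono, of 1 "Suc k"] by auto
  define app where "app f ts = (if (f, length ts) \<in> set (term_syms ?F) then Fun f ts else c)" for f ts
  have app: "app f ts \<in> G (Suc k)" if "set ts \<subseteq> G k" for f ts k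
  proof (cases "(f, length ts) \<in> set (term_syms ?F)")
    case True
    have "height t \<le> k \<and> set (syms_tm t) \<subseteq> set (term_syms ?F) \<and> fv_tm t \<subseteq> fv ?F" if "t \<in> set ts" for t
      using that \<open>set ts \<subseteq> G k\<close> G by blast
    then show ?thesis
      using True unfolding app_def G height_le_iff if_P[OF True] by (auto simp del: height.simps)
  next
    case False
    then show ?thesis using cG by (simp add: app_def)
  qed
  let ?\<sigma> = "\<lambda>x. if x \<in> fv ?F then Var x else c"
  let ?s = "\<lambda>r. app (Sko (binder_at A r))"
  have "range ?\<sigma> \<subseteq> G 1" using c by (auto simp: G)
  then have rk: "ranked G (\<lambda>f. app (Sym f)) ?\<sigma> ?s"
    using mono app by (auto simp: ranked_def ranked_skolem_def)
  \<comment> \<open>On the symbols of \<open>A\<close> the total interpretation agrees with the free one.\<close>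
  have "skolem_truth I (G m) A" for I
  proof -
    have "truth_blind I (\<lambda>f. app (Sym f)) (G m) True ?\<sigma> ?s A"
      using v rk unfolding valid_below_def by blast
    then have "truth I (\<lambda>f. app (Sym f)) (\<lambda>t. t) (G m) True ?\<sigma> (\<lambda>r y. app (Sko y)) A"
      using truth_binder_at[of I "\<lambda>f. app (Sym f)" "\<lambda>t. t" "G m" True ?\<sigma> "\<lambda>r y. app (Sko y)" A]
      by simp
    moreover have "truth (\<lambda>p ds. I p (map (\<lambda>d. d) ds)) (\<lambda>f. app (Sym f)) (\<lambda>t. t) (G m) True ?\<sigma> (\<lambda>r y. app (Sko y)) A
        = skolem_truth I (G m) A"
    proof (rule truth_hom)
      fix f and ds :: "'f ext tm list" assume "(f, length ds) \<in> set (syms A)"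
      then have "(Sym f, length ds) \<in> set (syms ?F)"
        unfolding rectified_outer_skolemized(4)[OF A] by force
      then show "app (Sym f) ds = Fun (Sym f) (map (\<lambda>d. d) ds)" by (simp add: app_def term_syms_def)
    next
      fix y and as :: "'f ext tm list" assume "(y, length as) \<in> set (skolems True A)"
      then have "(Sko y, length as) \<in> set (syms ?F)"
        unfolding rectified_outer_skolemized(4)[OF A] by force
      then show "app (Sko y) as = Fun (Sko y) as" by (simp add: app_def term_syms_def)
    qed (use rectified_outer_skolemized(2)[OF A] in auto)
    ultimately show ?thesis by simp
  qed
  moreover have "G m = {} \<longrightarrow> gamma_free True A"
    using gf cG[of "m - 1"] by (cases m) auto
  ultimately show ?thesis unfolding property_C_truth[OF A] G_def by simp
qed

theorem derivation_property_C:
  assumes "rectified A" "sentential_tautology B" "derivation B D A"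
  shows "property_C (witness_order D) A"
proof -
  have w: "witness_order D = Suc (sum_list (map (\<lambda>(r, K). rule_height r) D))"
  proof -
    have "(case r of Gamma t \<Rightarrow> height t | _ \<Rightarrow> 0) = rule_height r" for r :: "'a rule"
      by (cases r) auto
    then show ?thesis by (simp add: witness_order_def)
  qed
  have "valid_below (0 + sum_list (map (\<lambda>(r, K). rule_height r) D)) A"
    using derivation_valid_below[OF assms(3) tautology_valid_below[OF assms(2)]] .
  moreover have "gamma_free True B"
  proof -
    have "qfree B' \<Longrightarrow> gamma_free pos B'" for B' :: "('a, 'b) fm" and pos
      unfolding qfree_def by (induction B' arbitrary: pos) auto
    then show ?thesis using assms(2) by (simp add: sentential_tautology_def)
  qed
  ultimately show ?thesis
    unfolding w using derivation_gamma_free[OF assms(3)] valid_below_property_C[OF assms(1)] by simp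
qed

section \<open>Backward search\<close>
text \<open>
  The Skolem terms, as pairs of variable and arguments, of all instances of \<open>\<delta>\<close>-quantifiers that the
  search will still come across.
\<close>
fun pending_fm ::
  "'f ext tm list \<Rightarrow> bool \<Rightarrow> 'f ext tm list \<Rightarrow> ('f, 'p) fm \<Rightarrow> (nat \<times> 'f ext tm list) list" where
  "pending_fm T pos args (Atom p ts) = []"
| "pending_fm T pos args (Neg H) = pending_fm T (\<not> pos) args H"
| "pending_fm T pos args (Or H K) = pending_fm T pos args H @ pending_fm T pos args K"
| "pending_fm T pos args (And H K) = pending_fm T pos args H @ pending_fm T pos args K"
| "pending_fm T pos args (Qt q x H) =
     (if is_gamma pos q then concat (map (\<lambda>t. pending_fm T pos (args @ [t]) H) T)
      else (x, args) # pending_fm T pos args H)"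

fun pending :: "'f ext tm list \<Rightarrow> ('f, 'p) goal \<Rightarrow> (nat \<times> 'f ext tm list) list" where
  "pending T (GAtom p ts) = []"
| "pending T (GNeg g) = pending T g"
| "pending T (GOr g h) = pending T g @ pending T h"
| "pending T (GAnd g h) = pending T g @ pending T h"
| "pending T (GGamma pos q x H args ts) =
     concat (map (\<lambda>t. pending_fm T pos (args @ [t]) H) ts)"
| "pending T (GDelta pos q y H args) = (y, args) # pending_fm T pos args H"

lemma goal_fm_goal_of [simp]: "goal_fm (goal_of T pos args H) = H"
  by (induction H arbitrary: pos) auto

lemma pending_goal_of [simp]: "pending T (goal_of T pos args H) = pending_fm T pos args H"
  by (induction H arbitrary: pos) auto

lemma pending_fm_subst [simp]: "pending_fm T pos args (subst x t H) = pending_fm T pos args H"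
  by (induction H arbitrary: pos args) auto

lemma gamma_free_subst [simp]: "gamma_free pos (subst x t H) = gamma_free pos H"
  by (induction H arbitrary: pos) auto

lemma fv_subst_subset: "fv (subst x t H) \<subseteq> fv H - {x} \<union> fv_tm t"
  by (induction H) (auto simp: fv_subst_tm split: if_splits)

lemma pending_fm_skolems:
  "(y, as) \<in> set (pending_fm T pos args H) \<Longrightarrow>
    y \<in> set (quantified H) \<and>
    (\<exists>bs. as = args @ bs \<and> set bs \<subseteq> set T \<and> (y, length bs) \<in> set (skolems pos H))"
proof (induction H arbitrary: pos args)
  case (Qt q x H)
  show ?case
  proof (cases "is_gamma pos q")
    case True
    then obtain t where t: "t \<in> set T" "(y, as) \<in> set (pending_fm T pos (args @ [t]) H)"
      using Qt.prems by auto
    from Qt.IH[OF this(2)] obtain bs where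
      "y \<in> set (quantified H)" "as = args @ t # bs" "set bs \<subseteq> set T"
      "(y, length bs) \<in> set (skolems pos H)" by auto
    then show ?thesis using True t(1) by (auto intro!: exI[of _ "t # bs"] rev_image_eqI)
  next
    case False
    then show ?thesis using Qt.prems Qt.IH[of pos args] by auto
  qed
qed fastforce+

lemma distinct_concat_map:
  assumes "distinct ts" "\<And>t. t \<in> set ts \<Longrightarrow> distinct (f t)"
    and "\<And>t u. t \<noteq> u \<Longrightarrow> set (f t) \<inter> set (f u) = {}"
  shows "distinct (concat (map f ts))"
  using assms(1,2)
proof (induction ts)
  case (Cons t ts)
  have "set (f t) \<inter> set (f u) = {}" if "u \<in> set ts" for u
    using that Cons.prems(1) assms(3)[of t u] by auto
  then show ?case using Cons by auto
qed simp

text \<open>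
  Different instances of the same \<open>\<delta>\<close>-quantifier have different arguments, and different
  quantifiers have different variables.
\<close>
lemma distinct_pending_fm:
  assumes "distinct T" "distinct (quantified H)"
  shows "distinct (pending_fm T pos args H)"
  using assms(2)
proof (induction H arbitrary: pos args)
  case (Or H K)
  then show ?case by (fastforce dest: pending_fm_skolems)
next
  case (And H K)
  then show ?case by (fastforce dest: pending_fm_skolems)
next
  case (Qt q x H)
  show ?case
  proof (cases "is_gamma pos q")
    case True
    have "set (pending_fm T pos (args @ [t]) H) \<inter> set (pending_fm T pos (args @ [u]) H) = {}"
      if "t \<noteq> u" for t u
      using that by (auto dest!: pending_fm_skolems)
    then show ?thesis using True Qt assms(1) by (simp add: distinct_concat_map)
  next
    case False
    then show ?thesis using Qt by (auto dest: pending_fm_skolems)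
  qed
qed auto

lemma level_le_iff: "level ts \<le> k \<longleftrightarrow> (\<forall>t\<in>set ts. height t \<le> k)"
  by (auto simp: level_def)

lemma level_mono: "set ts \<subseteq> set us \<Longrightarrow> level ts \<le> level us"
  using level_le_iff[of us "level us"] by (auto simp: level_le_iff)

text \<open>
  Instances of a \<open>\<gamma>\<close>-quantifier are kept sorted by height, so that the level of the first one, which
  is all that \<open>levels\<close> shows, bounds the others from below. The list of remaining instances is never
  empty: with \<open>T = []\<close> there are no \<open>\<gamma>\<close>-quantifiers at all. Hence a goal without levels has no
  quantifiers.
\<close>
fun wf_goal :: "'f ext tm list \<Rightarrow> nat set \<Rightarrow> bool \<Rightarrow> ('f, 'p) goal \<Rightarrow> bool" where
  "wf_goal T V pos (GAtom p ts) = True"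
| "wf_goal T V pos (GNeg g) = wf_goal T V (\<not> pos) g"
| "wf_goal T V pos (GOr g h) = (wf_goal T V pos g \<and> wf_goal T V pos h)"
| "wf_goal T V pos (GAnd g h) = (wf_goal T V pos g \<and> wf_goal T V pos h)"
| "wf_goal T V pos (GGamma p q x H args ts) =
     (p = pos \<and> is_gamma pos q \<and> distinct (x # quantified H) \<and> set (x # quantified H) \<subseteq> V \<and>
      ts \<noteq> [] \<and> set ts \<subseteq> set T \<and> sorted (map height ts))"
| "wf_goal T V pos (GDelta p q y H args) =
     (p = pos \<and> \<not> is_gamma pos q \<and> distinct (y # quantified H) \<and> set (y # quantified H) \<subseteq> V \<and>
      (T = [] \<longrightarrow> gamma_free pos H))"

lemma wf_goal_of:
  assumes "sorted (map height T)" "distinct (quantified H)" "set (quantified H) \<subseteq> V"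
    "T = [] \<longrightarrow> gamma_free pos H"
  shows "wf_goal T V pos (goal_of T pos args H)"
  using assms by (induction H arbitrary: pos) auto

lemma pending_level:
  assumes "wf_goal T V pos g" "(y, as) \<in> set (pending T g)"
  shows "\<exists>l\<in>set (levels g). l \<le> level as"
  using assms
proof (induction g arbitrary: pos)
  case (GGamma p q x H args ts)
  obtain t ts' where ts: "ts = t # ts'" using GGamma by (cases ts) auto
  \<comment> \<open>The first instance \<open>t\<close> determines the level; it is at most as high as the instance \<open>u\<close> that leads to \<open>y\<close>.\<close>
  obtain u where u: "u \<in> set ts" "(y, as) \<in> set (pending_fm T p (args @ [u]) H)"
    using GGamma by auto
  have "height t \<le> height u" using u(1) GGamma ts by auto
  moreover have "level (args @ [u]) \<le> level as"
    using pending_fm_skolems[OF u(2)] by (auto intro!: level_mono)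
  ultimately have "level (args @ [t]) \<le> level as"
    using level_le_iff[of "args @ [u]" "level as"] by (simp add: level_le_iff)
  then show ?case using ts by simp
next
  case (GDelta p q x H args)
  then show ?case by (auto dest!: pending_fm_skolems intro!: level_mono)
qed fastforce+

text \<open>
  An upper bound for the number of backward steps when each \<open>\<gamma>\<close>-quantifier has \<open>N\<close> instances. In a
  goal, \<open>l\<close> remaining instances cost \<open>l\<close> instantiations and \<open>l - 1\<close> duplications; the subtracted
  \<open>1\<close> in \<open>weight\<close> makes a duplication count. For simplicity \<open>\<delta>\<close>-quantifiers in formulas are charged
  like \<open>\<gamma>\<close>-quantifiers.
\<close>
fun weight_fm :: "nat \<Rightarrow> ('f, 'p) fm \<Rightarrow> nat" where
  "weight_fm N (Atom p ts) = 0"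
| "weight_fm N (Neg H) = weight_fm N H"
| "weight_fm N (Or H K) = weight_fm N H + weight_fm N K"
| "weight_fm N (And H K) = weight_fm N H + weight_fm N K"
| "weight_fm N (Qt q x H) = Suc N * (weight_fm N H + 2)"

fun weight :: "nat \<Rightarrow> ('f, 'p) goal \<Rightarrow> nat" where
  "weight N (GAtom p ts) = 0"
| "weight N (GNeg g) = weight N g"
| "weight N (GOr g h) = weight N g + weight N h"
| "weight N (GAnd g h) = weight N g + weight N h"
| "weight N (GGamma pos q x H args ts) = length ts * (weight_fm N H + 2) - 1"
| "weight N (GDelta pos q y H args) = Suc (weight_fm N H)"

lemma weight_fm_subst [simp]: "weight_fm N (subst x t H) = weight_fm N H"
  by (induction H) auto

lemma weight_goal_of: "weight (length T) (goal_of T pos args H) \<le> weight_fm (length T) H"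
proof (induction H arbitrary: pos)
  case (Or H K)
  then show ?case using add_mono by fastforce
next
  case (And H K)
  then show ?case using add_mono by fastforce
qed auto

text \<open>
  The backward step as a relation, which does not say that the leftmost quantifier of level \<open>k\<close> is
  chosen. Its induction rule treats the three kinds of steps once, apart from their context.
\<close>
inductive reduces ::
  "('f ext tm \<Rightarrow> 'f tm) \<Rightarrow> 'f ext tm list \<Rightarrow> nat \<Rightarrow> bool \<Rightarrow> 'f rule
    \<Rightarrow> ('f, 'p) goal \<Rightarrow> ('f, 'p) goal \<Rightarrow> bool" for e T k where
  instantiate: "level (args @ [t]) = k \<Longrightarrow>
    reduces e T k pos (Gamma (e t)) (GGamma pos q x H args [t])
      (goal_of T pos (args @ [t]) (subst x (e t) H))"
| duplicate: "level (args @ [t]) = k \<Longrightarrow> ts \<noteq> [] \<Longrightarrow>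
    reduces e T k pos Simplification (GGamma pos q x H args (t # ts))
      ((if pos then GOr else GAnd) (GGamma pos q x H args [t]) (GGamma pos q x H args ts))"
| skolem: "level args = k \<Longrightarrow>
    reduces e T k pos Delta (GDelta pos q y H args)
      (goal_of T pos args (subst y (e (Fun (Sko y) args)) H))"
| neg: "reduces e T k (\<not> pos) r g g' \<Longrightarrow> reduces e T k pos r (GNeg g) (GNeg g')"
| orL: "reduces e T k pos r g g' \<Longrightarrow> reduces e T k pos r (GOr g h) (GOr g' h)"
| orR: "reduces e T k pos r h h' \<Longrightarrow> reduces e T k pos r (GOr g h) (GOr g h')"
| andL: "reduces e T k pos r g g' \<Longrightarrow> reduces e T k pos r (GAnd g h) (GAnd g' h)"
| andR: "reduces e T k pos r h h' \<Longrightarrow> reduces e T k pos r (GAnd g h) (GAnd g h')"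

lemma back_step_reduces:
  assumes "wf_goal T V pos g" "back_step e T k g = Some (r, g')"
  shows "reduces e T k pos r g g'"
  using assms
proof (induction g arbitrary: pos r g')
  case (GGamma p q x H args ts)
  obtain t ts' where ts: "ts = t # ts'" using GGamma by (cases ts) auto
  show ?case
    using GGamma instantiate[of args t k e T p q x H] duplicate[of args t k ts' e T p q x H]
    unfolding ts by (auto split: if_splits)
next
  case (GDelta p q y H args)
  then show ?case using skolem[of args k e T p q y H] by (auto split: if_splits)
qed (auto split: option.splits intro: reduces.intros)

lemma back_step_progress:
  assumes "k \<in> set (levels g)"
  shows "\<exists>r g'. back_step e T k g = Some (r, g')"
  using assms
proof (induction g)
  case (GNeg g)
  then show ?case by fastforce
next
  case (GOr g h)
  then show ?case by (fastforce split: option.splits)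
next
  case (GAnd g h)
  then show ?case by (fastforce split: option.splits)
qed (auto split: list.splits)

lemma reduces_weight:
  assumes "reduces e T k pos r g g'"
  shows "weight (length T) g' < weight (length T) g"
  using assms
proof (induction rule: reduces.induct)
  case (instantiate args t pos q x H)
  show ?case
    using weight_goal_of[of T pos "args @ [t]" "subst x (e t) H"] by simp
next
  case (duplicate args t ts pos q x H)
  have "0 < length ts * (weight_fm (length T) H + 2)" using duplicate by simp
  then show ?case by simp
next
  case (skolem args pos q y H)
  show ?case
    using weight_goal_of[of T pos args "subst y (e (Fun (Sko y) args)) H"] by simp
qed simp_all

lemma reduces_wf:
  assumes "reduces e T k pos r g g'" "wf_goal T V pos g" "sorted (map height T)"
  shows "wf_goal T V pos g'"
  using assms
proof (induction rule: reduces.induct)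
  case (instantiate args t pos q x H)
  then show ?case by (intro wf_goal_of) auto
next
  case (skolem args pos q y H)
  then show ?case by (intro wf_goal_of) auto
qed auto

text \<open>
  This is the implicit renaming that \<open>\<delta>\<^sup>-\<close>-quantification allows: read forward, the variable \<open>v\<close>
  is quantified and renamed to \<open>y\<close>.
\<close>
lemma alpha_fresh_instance:
  assumes "v \<notin> fv H" "v \<notin> set (quantified H)" "y \<notin> set (quantified H)"
  shows "variant (Qt q y H) (Qt q v (subst y (Var v) H))"
proof -
  \<comment> \<open>Quantifiers passed inside \<open>H\<close> keep their variable and come before the renamed one.\<close>
  let ?bs = "\<lambda>zs. map (\<lambda>z. (z, z)) zs @ [(y, v)]"
  have var: "same_var (?bs zs) x (if x = y then v else x)"
    if "y \<notin> set zs" "v \<notin> set zs" "x \<noteq> v \<or> v = y" for zs x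
    using that by (induction zs) auto
  have tm: "alpha_tm (?bs zs) u (subst_tm y (Var v) u)"
    if "y \<notin> set zs" "v \<notin> set zs" "v \<notin> fv_tm u" for zs u
    using that(3)
  proof (induction u)
    case (Var x)
    then show ?case using var[OF that(1,2), of x] by auto
  next
    case (Fun f us)
    have "alpha_tm (?bs zs) u (subst_tm y (Var v) u)" if "u \<in> set us" for u
      using that Fun by auto
    then show ?case by (simp add: list_all2_conv_all_nth)
  qed
  have "alpha (?bs zs) H (subst y (Var v) H)" if "y \<notin> set zs" "v \<notin> set zs" for zs
    using that assms
  proof (induction H arbitrary: zs)
    case (Atom p ts)
    have "alpha_tm (?bs zs) u (subst_tm y (Var v) u)" if "u \<in> set ts" for u
      using that Atom by (intro tm) auto
    then show ?case by (simp add: list_all2_conv_all_nth)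
  next
    case (Qt q x H)
    then show ?case using Qt.IH[of "x # zs"] by auto
  qed auto
  from this[of "[]"] show ?thesis by (simp add: variant_def)
qed

lemma variant_refl: "variant H H"
proof -
  have sv: "same_var (map (\<lambda>z. (z, z)) zs) x x" for zs x by (induction zs) auto
  have tm: "alpha_tm (map (\<lambda>z. (z, z)) zs) u u" for zs and u :: "'a tm"
  proof (induction u)
    case (Fun f us)
    then show ?case by (auto simp: list_all2_conv_all_nth)
  qed (simp add: sv)
  have "alpha (map (\<lambda>z. (z, z)) zs) H H" for zs
  proof (induction H arbitrary: zs)
    case (Qt q x H)
    then show ?case using Qt[of "x # zs"] by simp
  qed (auto simp: list_all2_conv_all_nth tm)
  from this[of "[]"] show ?thesis by (simp add: variant_def)
qed

lemma fv_fill_accessible: "accessible C \<Longrightarrow> fv (fill C H) = fv_ctx C \<union> fv H"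
  by (induction C) auto

text \<open>
  What the search needs to know about the translation \<open>e\<close> of instances: it names the Skolem terms in
  \<open>S\<close> by pairwise different variables, avoids the set \<open>V\<close> of bound variables, and introduces the name of
  a Skolem term only with instances that are higher than its arguments.
\<close>
locale skolem_naming =
  fixes e :: "'f ext tm \<Rightarrow> 'f tm" and T :: "'f ext tm list" and V :: "nat set"
    and S :: "(nat \<times> 'f ext tm list) set" and var :: "nat \<times> 'f ext tm list \<Rightarrow> nat"
  assumes e_skolem: "(y, as) \<in> S \<Longrightarrow> e (Fun (Sko y) as) = Var (var (y, as))"
    and var_inj: "inj_on var S"
    and var_fresh: "p \<in> S \<Longrightarrow> var p \<notin> V"
    and e_fresh: "t \<in> set T \<Longrightarrow> fv_tm (e t) \<inter> V = {}"
    and e_height: "t \<in> set T \<Longrightarrow> p \<in> S \<Longrightarrow> var p \<in> fv_tm (e t) \<Longrightarrow> level (snd p) < height t"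
    and T_sorted: "sorted (map height T)"
begin

definition fresh_goal :: "('f, 'p) goal \<Rightarrow> bool" where
  "fresh_goal g \<longleftrightarrow> distinct (pending T g) \<and> set (pending T g) \<subseteq> S \<and>
     (\<forall>p\<in>set (pending T g). var p \<notin> fv (goal_fm g))"

text \<open>
  The effect of a backward step on the pending Skolem terms \<open>ps\<close> and the free variables \<open>X\<close> of a
  goal: either an instance of height at most \<open>k\<close> comes in and nothing pending is resolved, or one
  pending Skolem term is resolved and its name comes in.
\<close>
definition consumes ::
  "nat \<Rightarrow> (nat \<times> 'f ext tm list) list \<Rightarrow> nat set \<Rightarrow> (nat \<times> 'f ext tm list) list \<Rightarrow> nat set \<Rightarrow> bool" where
  "consumes k ps X ps' X' \<longleftrightarrow>
     (ps' = ps \<and> (\<exists>t\<in>set T. height t \<le> k \<and> X' \<subseteq> X \<union> fv_tm (e t))) \<or>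
     (\<exists>xs p ys. ps = xs @ p # ys \<and> ps' = xs @ ys \<and> X' \<subseteq> X \<union> {var p})"

lemma consumes_context:
  assumes "consumes k ps X ps' X'"
  shows "consumes k (us @ ps @ vs) (Y \<union> X \<union> Z) (us @ ps' @ vs) (Y \<union> X' \<union> Z)"
  using assms unfolding consumes_def
proof (elim disjE exE conjE)
  fix xs p ys
  assume "ps = xs @ p # ys" "ps' = xs @ ys" "X' \<subseteq> X \<union> {var p}"
  then show "(us @ ps' @ vs = us @ ps @ vs \<and>
        (\<exists>t\<in>set T. height t \<le> k \<and> Y \<union> X' \<union> Z \<subseteq> Y \<union> X \<union> Z \<union> fv_tm (e t))) \<or>
     (\<exists>xs p ys. us @ ps @ vs = xs @ p # ys \<and> us @ ps' @ vs = xs @ ys \<and>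
        Y \<union> X' \<union> Z \<subseteq> Y \<union> X \<union> Z \<union> {var p})"
    by (intro disjI2 exI[of _ "us @ xs"] exI[of _ p] exI[of _ "ys @ vs"]) auto
qed auto

lemma reduces_consumes:
  assumes "reduces e T k pos r g g'" "wf_goal T V pos g" "set (pending T g) \<subseteq> S"
  shows "consumes k (pending T g) (fv (goal_fm g)) (pending T g') (fv (goal_fm g'))"
  using assms
proof (induction rule: reduces.induct)
  case (instantiate args t pos q x H)
  have "height t \<le> k" using instantiate(1) level_le_iff[of "args @ [t]" k] by simp
  then show ?case using instantiate fv_subst_subset[of x "e t" H] by (auto simp: consumes_def)
next
  case (duplicate args t ts pos q x H)
  have "height t \<le> k" using duplicate(1) level_le_iff[of "args @ [t]" k] by simp
  then show ?case using duplicate by (auto simp: consumes_def)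
next
  case (skolem args pos q y H)
  then have "e (Fun (Sko y) args) = Var (var (y, args))" by (simp add: e_skolem)
  then show ?case
    unfolding consumes_def using fv_subst_subset[of y "Var (var (y, args))" H]
    by (intro disjI2 exI[of _ "[]"] exI[of _ "(y, args)"] exI[of _ "pending_fm T pos args H"]) auto
next
  case (orL pos r g g' h)
  then show ?case
    using consumes_context[of k "pending T g" _ _ _ "[]" "pending T h" "{}" "fv (goal_fm h)"] by simp
next
  case (orR pos r h h' g)
  then show ?case
    using consumes_context[of k "pending T h" _ _ _ "pending T g" "[]" "fv (goal_fm g)" "{}"] by simp
next
  case (andL pos r g g' h)
  then show ?case
    using consumes_context[of k "pending T g" _ _ _ "[]" "pending T h" "{}" "fv (goal_fm h)"] by simp
next
  case (andR pos r h h' g)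
  then show ?case
    using consumes_context[of k "pending T h" _ _ _ "pending T g" "[]" "fv (goal_fm g)" "{}"] by simp
qed simp

text \<open>
  This is why the order of the steps guarantees the variable condition. All pending Skolem terms have
  arguments of level at least \<open>k\<close>, whereas a \<open>\<gamma>\<close>-instance used at level \<open>k\<close> has height at most \<open>k\<close> and
  thus contains only names of Skolem terms with arguments of level less than \<open>k\<close>. Names that come in
  with a \<open>\<delta>\<close>-step are no longer pending, because the pending Skolem terms are pairwise different.
\<close>
lemma reduces_fresh:
  assumes "reduces e T k pos r g g'" "wf_goal T V pos g" "fresh_goal g"
    and k: "\<And>l. l \<in> set (levels g) \<Longrightarrow> k \<le> l"
  shows "fresh_goal g'"
proof -
  have S: "set (pending T g) \<subseteq> S" using assms(3) by (simp add: fresh_goal_def)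
  have lev: "k \<le> level as" if "(y, as) \<in> set (pending T g)" for y as
    using pending_level[OF assms(2) that] k by force
  from reduces_consumes[OF assms(1,2) S] show ?thesis
    unfolding consumes_def
  proof (elim disjE exE conjE bexE)
    fix t
    assume t: "pending T g' = pending T g" "t \<in> set T" "height t \<le> k"
      "fv (goal_fm g') \<subseteq> fv (goal_fm g) \<union> fv_tm (e t)"
    have "var p \<notin> fv_tm (e t)" if "p \<in> set (pending T g)" for p
      using e_height[OF t(2), of p] lev[of "fst p" "snd p"] that S t(3) by force
    then show ?thesis using assms(3) t(1,4) by (auto simp: fresh_goal_def)
  next
    fix xs p ys
    assume "pending T g = xs @ p # ys" "pending T g' = xs @ ys"
      "fv (goal_fm g') \<subseteq> fv (goal_fm g) \<union> {var p}"
    moreover have "var p' \<noteq> var p" if "p' \<in> set (xs @ ys)" for p'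
    proof -
      have "p \<noteq> p'" "p \<in> S" "p' \<in> S"
        using that calculation(1) assms(3) by (auto simp: fresh_goal_def)
      then show ?thesis using var_inj by (auto dest: inj_onD)
    qed
    ultimately show ?thesis using assms(3) unfolding fresh_goal_def by auto
  qed
qed

text \<open>
  The inference at the position of a backward step. For a \<open>\<delta>\<close>-quantifier it refers to the pending Skolem
  term instead of the variable condition, because the latter concerns the whole formula and is
  not stable under adding a context.
\<close>
definition redex ::
  "(nat \<times> 'f ext tm list) set \<Rightarrow> bool \<Rightarrow> 'f rule \<Rightarrow> ('f, 'p) fm \<Rightarrow> ('f, 'p) fm \<Rightarrow> bool" where
  "redex Q pos r P K \<longleftrightarrow>
     (\<exists>q x H t. r = Gamma t \<and> is_gamma pos q \<and> K = Qt q x H \<and> P = subst x t H \<and>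
        fv_tm t \<inter> set (quantified H) = {}) \<or>
     (r = Simplification \<and> P = doubled pos K K) \<or>
     (\<exists>q y H p. r = Delta \<and> \<not> is_gamma pos q \<and> K = Qt q y H \<and> P = subst y (Var (var p)) H \<and>
        p \<in> Q \<and> distinct (y # quantified H) \<and> set (y # quantified H) \<subseteq> V)"

lemma redex_mono: "redex Q pos r P K \<Longrightarrow> Q \<subseteq> Q' \<Longrightarrow> redex Q' pos r P K"
  unfolding redex_def by blast

lemma reduces_redex:
  assumes "reduces e T k pos r g g'" "wf_goal T V pos g" "set (pending T g) \<subseteq> S"
  shows "\<exists>C P K. accessible C \<and> goal_fm g = fill C K \<and> goal_fm g' = fill C P \<and>
    redex (set (pending T g)) (pos = positive C) r P K"
  using assms
proof (induction rule: reduces.induct)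
  case (instantiate args t pos q x H)
  then show ?case using e_fresh[of t] by (intro exI[of _ Hole]) (auto simp: redex_def)
next
  case (duplicate args t ts pos q x H)
  then show ?case by (intro exI[of _ Hole]) (auto simp: doubled_def redex_def)
next
  case (skolem args pos q y H)
  then show ?case by (intro exI[of _ Hole]) (auto simp: e_skolem redex_def)
next
  case (neg pos r g g')
  then obtain C P K where "accessible C" "goal_fm g = fill C K" "goal_fm g' = fill C P"
    "redex (set (pending T g)) ((\<not> pos) = positive C) r P K" by auto
  moreover have "((\<not> pos) = positive C) = (pos = positive (CNeg C))" by auto
  ultimately show ?case
    by (intro exI[of _ "CNeg C"] exI[of _ P] exI[of _ K]) simp
next
  case (orL pos r g g' h)
  then obtain C P K where "accessible C" "goal_fm g = fill C K" "goal_fm g' = fill C P"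
    "redex (set (pending T g)) (pos = positive C) r P K" by auto
  then show ?case
    by (intro exI[of _ "COrL C (goal_fm h)"] exI[of _ P] exI[of _ K]) (auto intro: redex_mono)
next
  case (orR pos r h h' g)
  then obtain C P K where "accessible C" "goal_fm h = fill C K" "goal_fm h' = fill C P"
    "redex (set (pending T h)) (pos = positive C) r P K" by auto
  then show ?case
    by (intro exI[of _ "COrR (goal_fm g) C"] exI[of _ P] exI[of _ K]) (auto intro: redex_mono)
next
  case (andL pos r g g' h)
  then obtain C P K where "accessible C" "goal_fm g = fill C K" "goal_fm g' = fill C P"
    "redex (set (pending T g)) (pos = positive C) r P K" by auto
  then show ?case
    by (intro exI[of _ "CAndL C (goal_fm h)"] exI[of _ P] exI[of _ K]) (auto intro: redex_mono)
next
  case (andR pos r h h' g)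
  then obtain C P K where "accessible C" "goal_fm h = fill C K" "goal_fm h' = fill C P"
    "redex (set (pending T h)) (pos = positive C) r P K" by auto
  then show ?case
    by (intro exI[of _ "CAndR (goal_fm g) C"] exI[of _ P] exI[of _ K]) (auto intro: redex_mono)
qed

lemma reduces_infer:
  assumes "reduces e T k True r g g'" "wf_goal T V True g" "fresh_goal g"
  shows "infer r (goal_fm g') (goal_fm g)"
proof -
  have S: "set (pending T g) \<subseteq> S" using assms(3) by (simp add: fresh_goal_def)
  from reduces_redex[OF assms(1,2) S] obtain C P K where
    C: "accessible C" "goal_fm g = fill C K" "goal_fm g' = fill C P"
    and "redex (set (pending T g)) (positive C) r P K"
    by auto
  from this(4) show ?thesis
    unfolding redex_def
  proof (elim disjE exE conjE)
    fix q x H t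
    assume "r = Gamma t" "is_gamma (positive C) q" "K = Qt q x H" "P = subst x t H"
      "fv_tm t \<inter> set (quantified H) = {}"
    then show ?thesis unfolding C using C(1) variant_refl by (auto intro: infer.gamma)
  next
    assume "r = Simplification" "P = doubled (positive C) K K"
    then show ?thesis unfolding C using variant_refl by (auto intro: infer.simplification)
  next
    fix q y H p
    assume r: "r = Delta" "\<not> is_gamma (positive C) q" "K = Qt q y H" "P = subst y (Var (var p)) H"
      and p: "p \<in> set (pending T g)" and y: "distinct (y # quantified H)" "set (y # quantified H) \<subseteq> V"
    have v: "var p \<notin> fv_ctx C \<union> fv (Qt q y H)"
      using p assms(3) C fv_fill_accessible[OF C(1), of K] r(3) by (auto simp: fresh_goal_def)
    have "var p \<notin> V" using p S var_fresh by blast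
    then have "variant (Qt q y H) (Qt q (var p) (subst y (Var (var p)) H))"
      using v y by (intro alpha_fresh_instance) auto
    then show ?thesis unfolding C r using C(1) r(2) v by (intro infer.delta) auto
  qed
qed

definition branch_truth ::
  "('p \<Rightarrow> 'f tm list \<Rightarrow> bool) \<Rightarrow> bool \<Rightarrow> (nat \<Rightarrow> 'f tm) \<Rightarrow> 'f ext tm list \<Rightarrow> ('f, 'p) fm \<Rightarrow> bool" where
  "branch_truth J pos \<sigma> args =
     truth J Fun e (set T) pos \<sigma> (\<lambda>r y as. e (Fun (Sko y) (args @ as)))"

text \<open>
  The truth value of the formula that the search will end with.
\<close>
fun goal_truth :: "('p \<Rightarrow> 'f tm list \<Rightarrow> bool) \<Rightarrow> ('f, 'p) goal \<Rightarrow> bool" where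
  "goal_truth J (GAtom p ts) = J p ts"
| "goal_truth J (GNeg g) = (\<not> goal_truth J g)"
| "goal_truth J (GOr g h) = (goal_truth J g \<or> goal_truth J h)"
| "goal_truth J (GAnd g h) = (goal_truth J g \<and> goal_truth J h)"
| "goal_truth J (GGamma pos q x H args ts) =
     (if q = Exists then \<exists>t\<in>set ts. branch_truth J pos (Var(x := e t)) (args @ [t]) H
      else \<forall>t\<in>set ts. branch_truth J pos (Var(x := e t)) (args @ [t]) H)"
| "goal_truth J (GDelta pos q y H args) =
     branch_truth J pos (Var(y := e (Fun (Sko y) args))) args H"

lemma goal_truth_goal_of: "goal_truth J (goal_of T pos args H) = branch_truth J pos Var args H"
  by (induction H arbitrary: pos) (auto simp: branch_truth_def map_idI)

lemma branch_truth_subst: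
  assumes "fv_tm t \<inter> set (quantified H) = {}"
  shows "branch_truth J pos Var args (subst x t H) = branch_truth J pos (Var(x := t)) args H"
  using assms by (simp add: branch_truth_def truth_subst)

lemma reduces_truth:
  assumes "reduces e T k pos r g g'" "wf_goal T V pos g" "set (pending T g) \<subseteq> S"
  shows "goal_truth J g' = goal_truth J g"
  using assms
proof (induction rule: reduces.induct)
  case (instantiate args t pos q x H)
  then have "fv_tm (e t) \<inter> set (quantified H) = {}" using e_fresh[of t] by auto
  then show ?case by (simp add: goal_truth_goal_of branch_truth_subst)
next
  case (duplicate args t ts pos q x H)
  then show ?case by (auto simp: is_gamma_def)
next
  case (skolem args pos q y H)
  then have "fv_tm (e (Fun (Sko y) args)) \<inter> set (quantified H) = {}"
    using var_fresh[of "(y, args)"] by (auto simp: e_skolem)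
  then show ?case by (simp add: goal_truth_goal_of branch_truth_subst)
qed auto

lemma levels_Nil:
  assumes "wf_goal T V pos g" "levels g = []"
  shows "qfree (goal_fm g) \<and> goal_truth J g = sent_eval J (goal_fm g)"
  using assms by (induction g arbitrary: pos) (auto simp: qfree_def split: list.splits)

text \<open>
  The loop invariant combines well-formedness, freshness, the derivation found so far, and the truth
  value of the final formula, which no step changes.
\<close>
lemma back_search:
  fixes A :: "('f, 'p) fm"
  assumes A: "distinct (quantified A)" "set (quantified A) \<subseteq> V" "T = [] \<longrightarrow> gamma_free True A"
    and "distinct T" and S: "set (pending_fm T True [] A) \<subseteq> S"
    and fvA: "\<And>p. p \<in> S \<Longrightarrow> var p \<notin> fv A"
    and w: "while (\<lambda>(g, D). levels g \<noteq> [])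
              (\<lambda>(g, D).
                 case back_step e T (Min (set (levels g))) g of
                   Some (r, g') \<Rightarrow> (g', (r, goal_fm g) # D)
                 | None \<Rightarrow> (g, D))
              (goal_of T True [] A, []) = (g, D)"
  shows "derivation (goal_fm g) D A \<and> qfree (goal_fm g) \<and>
    (\<forall>J. sent_eval J (goal_fm g) = branch_truth J True Var [] A)"
proof -
  define inv :: "('f, 'p) goal \<times> ('f, 'p) deriv \<Rightarrow> bool" where
    "inv = (\<lambda>(g, D). wf_goal T V True g \<and> fresh_goal g \<and> derivation (goal_fm g) D A \<and>
       (\<forall>J. goal_truth J g = branch_truth J True Var [] A))"
  let ?step = "\<lambda>(g, D). case back_step e T (Min (set (levels g))) g of
                   Some (r, g') \<Rightarrow> (g', (r, goal_fm g) # D)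
                 | None \<Rightarrow> (g, D)"
  have step: "inv (?step (g, D)) \<and> weight (length T) (fst (?step (g, D))) < weight (length T) g"
    if i: "inv (g, D)" and l: "levels g \<noteq> []" for g D
  proof -
    let ?k = "Min (set (levels g))"
    have k: "?k \<in> set (levels g)" using l by (intro Min_in) auto
    obtain r g' where b: "back_step e T ?k g = Some (r, g')"
      using back_step_progress[OF k] by blast
    have wf: "wf_goal T V True g" and fr: "fresh_goal g" using i by (auto simp: inv_def)
    have red: "reduces e T ?k True r g g'" using back_step_reduces[OF wf b] .
    have "set (pending T g) \<subseteq> S" using fr by (simp add: fresh_goal_def)
    then have "goal_truth J g' = goal_truth J g" for J using reduces_truth[OF red wf] by blast
    moreover have "fresh_goal g'" using reduces_fresh[OF red wf fr] by simp
    ultimately show ?thesis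
      using i b reduces_wf[OF red wf T_sorted] reduces_weight[OF red] reduces_infer[OF red wf fr]
      by (simp add: inv_def)
  qed
  have init: "inv (goal_of T True [] A, [])"
    using A S fvA \<open>distinct T\<close> T_sorted
    by (auto simp: inv_def fresh_goal_def goal_truth_goal_of wf_goal_of distinct_pending_fm)
  have "inv (g, D) \<and> levels (fst (g, D)) = []"
    unfolding w[symmetric]
  proof (rule while_rule[where P = inv and r = "measure (\<lambda>(g, D). weight (length T) g)"])
    show "inv (goal_of T True [] A, [])" by (rule init)
  next
    fix s assume "inv s" "case s of (g, D) \<Rightarrow> levels g \<noteq> []"
    then show "inv (?step s)" using step by (cases s) auto
  next
    fix s assume "inv s" "case s of (g, D) \<Rightarrow> levels g \<noteq> []"
    then show "(?step s, s) \<in> measure (\<lambda>(g, D). weight (length T) g)"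
      using step by (cases s) (auto simp: case_prod_beta)
  next
    fix s assume "inv s" "\<not> (case s of (g, D) \<Rightarrow> levels g \<noteq> [])"
    then show "inv s \<and> levels (fst s) = []" by (cases s) auto
  qed auto
  then show ?thesis using levels_Nil[of True g] by (auto simp: inv_def)
qed

end

section \<open>Variables as names of Skolem terms\<close>
definition index_of :: "'a list \<Rightarrow> 'a \<Rightarrow> nat" where
  "index_of us u = length (takeWhile (\<lambda>z. z \<noteq> u) us)"

lemma index_of_eq:
  assumes "index_of us u = index_of us u'" "u \<in> set us" "u' \<in> set us"
  shows "u = u'"
proof -
  have "us ! index_of us z = z" if "z \<in> set us" for z
    using that nth_length_takeWhile[of "\<lambda>w. w \<noteq> z" us]
      takeWhile_eq_all_conv[of "\<lambda>w. w \<noteq> z" us] takeWhile_eq_take[of "\<lambda>w. w \<noteq> z" us]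
    unfolding index_of_def by (metis linorder_not_less take_all)
  then show ?thesis using assms by metis
qed

lemma height_level: "height (Fun f ts) = Suc (level ts)"
  by (simp add: level_def)

text \<open>
  A variable of the translated term either was there before or is the name of a subterm \<open>u\<close>.
\<close>
lemma fv_unskolem:
  assumes "x \<in> fv_tm (unskolem b us t)"
  shows "x \<in> fv_tm t \<or> (\<exists>u. x = b + index_of us u \<and> height u \<le> height t \<and>
    set (syms_tm u) \<subseteq> set (syms_tm t) \<and> fv_tm u \<subseteq> fv_tm t)"
  using assms
proof (induction t)
  case (Fun g ts)
  show ?case
  proof (cases g)
    case (Sym f)
    then obtain t where t: "t \<in> set ts" "x \<in> fv_tm (unskolem b us t)" using Fun.prems by auto
    have "height t \<le> height (Fun g ts)"
      using t(1) level_le_iff[of ts "level ts"] unfolding height_level by auto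
    have sub: "set (syms_tm t) \<subseteq> set (syms_tm (Fun g ts))" "fv_tm t \<subseteq> fv_tm (Fun g ts)"
      using t(1) by auto
    from Fun.IH[OF t] show ?thesis
    proof (elim disjE exE conjE)
      assume "x \<in> fv_tm t"
      then show ?thesis using sub(2) by blast
    next
      fix u
      assume "x = b + index_of us u" "height u \<le> height t"
        "set (syms_tm u) \<subseteq> set (syms_tm t)" "fv_tm u \<subseteq> fv_tm t"
      then show ?thesis
        using sub le_trans[OF _ \<open>height t \<le> height (Fun g ts)\<close>]
        by (intro disjI2 exI[of _ u]) blast
    qed
  next
    case (Sko y)
    then show ?thesis using Fun.prems by (intro disjI2 exI[of _ "Fun g ts"]) (simp add: index_of_def)
  next
    case Bullet
    then show ?thesis using Fun.prems by (intro disjI2 exI[of _ "Fun g ts"]) (simp add: index_of_def)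
  qed
qed simp

lemma distinct_term_list:
  assumes "distinct vs" "distinct fs"
  shows "distinct (term_list vs fs k)"
proof (induction k)
  case (Suc k)
  have "distinct (concat (map (\<lambda>(f, m). map (Fun f) (List.n_lists m (term_list vs fs k))) fs))"
    using assms(2) Suc
    by (intro distinct_concat_map)
      (auto simp: distinct_map inj_on_def set_n_lists intro!: distinct_n_lists)
  then show ?case using assms(1) by (auto simp: distinct_map inj_on_def)
qed simp

lemma distinct_term_syms:
  assumes "\<And>m. (Bullet, m) \<notin> set (syms F)"
  shows "distinct (term_syms F)"
  using assms by (auto simp: term_syms_def)

text \<open>
  The Skolem terms named by the construction have height at most \<open>n\<close>, as their arguments
  have height less than \<open>n\<close>; the list of terms with this bound contains all of them, so their
  positions in this list are pairwise different names.
\<close>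
theorem property_C_derivation:
  fixes A :: "('f, 'p) fm"
  assumes A: "rectified A" and n: "0 < n" "property_C n A"
    and w: "witness_derivation n A = (B, D)"
  shows "sentential_tautology B \<and> derivation B D A"
proof -
  let ?F = "outer_skolemized A"
  define us where "us = term_list (sorted_list_of_set (fv ?F)) (term_syms ?F)"
  define T where "T = sort_key height (us (n - 1))"
  define b where "b = Suc (Max (insert 0 (fv A \<union> set (quantified A))))"
  define e where "e = unskolem b (us n)"
  let ?V = "set (quantified A)"
  let ?S = "{(y, as). Fun (Sko y) as \<in> set (us n)}"
  let ?var = "\<lambda>(y, as). b + index_of (us n) (Fun (Sko y) as)"
  note F = rectified_outer_skolemized[OF A]
  have us: "set (us k) =
      {t. height t \<le> k \<and> set (syms_tm t) \<subseteq> set (term_syms ?F) \<and> fv_tm t \<subseteq> fv A}" for k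
    by (simp add: us_def set_term_list finite_fv F(2))
  have setT: "set T = terms_below n ?F"
    by (simp add: T_def us_def terms_below_term_list)
  have T_us: "set T \<subseteq> set (us n)" by (auto simp: T_def us)
  have b: "x < b" if "x \<in> fv A \<union> ?V" for x
    using that by (auto simp: b_def less_Suc_eq_le finite_fv intro!: Max_ge)
  have e_cases: "x \<in> fv A \<or> (\<exists>u\<in>set (us n). x = b + index_of (us n) u \<and> height u \<le> height t)"
    if "t \<in> set T" "x \<in> fv_tm (e t)" for t x
  proof -
    have "t \<in> set (us n)" using that(1) T_us by auto
    then have t: "height t \<le> n" "set (syms_tm t) \<subseteq> set (term_syms ?F)" "fv_tm t \<subseteq> fv A"
      unfolding us by auto
    from fv_unskolem[OF that(2)[unfolded e_def]] show ?thesis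
    proof (elim disjE exE conjE)
      assume "x \<in> fv_tm t"
      then show ?thesis using t(3) by blast
    next
      fix u
      assume u: "x = b + index_of (us n) u" "height u \<le> height t"
        "set (syms_tm u) \<subseteq> set (syms_tm t)" "fv_tm u \<subseteq> fv_tm t"
      then have "u \<in> set (us n)" unfolding us using t by auto
      then show ?thesis using u(1,2) by blast
    qed
  qed
  interpret skolem_naming e T ?V ?S ?var
  proof
    fix y as
    show "e (Fun (Sko y) as) = Var (?var (y, as))" by (simp add: e_def index_of_def)
  next
    show "inj_on ?var ?S" by (auto simp: inj_on_def dest!: index_of_eq)
  next
    fix p show "?var p \<notin> ?V" using b[of "?var p"] by (cases p) fastforce
  next
    fix t assume "t \<in> set T"
    show "fv_tm (e t) \<inter> ?V = {}"
    proof (intro equals0I)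
      fix x assume "x \<in> fv_tm (e t) \<inter> ?V"
      then have "x \<in> fv A \<or> b \<le> x" "x < b" "x \<in> ?V"
        using e_cases[OF \<open>t \<in> set T\<close>, of x] b[of x] by auto
      then show False using A by (auto simp: rectified_def)
    qed
  next
    fix t p assume t: "t \<in> set T" and p: "p \<in> ?S" "?var p \<in> fv_tm (e t)"
    obtain y as where p': "p = (y, as)" by (cases p)
    have "?var p \<notin> fv A" using b[of "?var p"] p' by auto
    then obtain u where u: "u \<in> set (us n)" "?var p = b + index_of (us n) u" "height u \<le> height t"
      using e_cases[OF t p(2)] by blast
    then have "u = Fun (Sko y) as" using p(1) p' by (auto dest!: index_of_eq)
    then show "level (snd p) < height t" 
      using u(3) p' by (simp add: height_level Suc_le_eq del: height.simps)
  next
    show "sorted (map height T)" by (simp add: T_def)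
  qed
  have bullet: "(Bullet, m) \<notin> set (syms ?F)" for m unfolding F(4) by auto
  have "distinct T"
    using distinct_term_list[OF distinct_sorted_list_of_set distinct_term_syms[OF bullet]]
    by (simp add: T_def us_def)
  moreover have "set (pending_fm T True [] A) \<subseteq> ?S"
  proof (intro subsetI, clarify)
    fix y as assume "(y, as) \<in> set (pending_fm T True [] A)"
    from pending_fm_skolems[OF this] have as: "set as \<subseteq> set T" "(y, length as) \<in> set (skolems True A)"
      by auto
    have sym: "(Sko y, length as) \<in> set (term_syms ?F)"
      using as(2) F(4) by (force simp: term_syms_def)
    have "set as \<subseteq> set (us (n - 1))" using as(1) by (simp add: T_def)
    then have "height t \<le> n - 1 \<and> set (syms_tm t) \<subseteq> set (term_syms ?F) \<and> fv_tm t \<subseteq> fv A"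
      if "t \<in> set as" for t using that unfolding us by blast
    moreover have "height (Fun (Sko y) as) \<le> Suc (n - 1)"
      unfolding height_le_iff using calculation by blast
    ultimately show "Fun (Sko y) as \<in> set (us n)"
      unfolding us using n(1) sym by (auto simp del: height.simps)
  qed
  moreover have "T = [] \<longrightarrow> gamma_free True A"
    using n(2) unfolding property_C_truth[OF A] setT[symmetric] by simp
  moreover have "?var p \<notin> fv A" for p using b[of "?var p"] by (cases p) fastforce
  moreover obtain g where g: "B = goal_fm g"
    "while (\<lambda>(g, D). levels g \<noteq> [])
       (\<lambda>(g, D).
          case back_step e T (Min (set (levels g))) g of
            Some (r, g') \<Rightarrow> (g', (r, goal_fm g) # D)
          | None \<Rightarrow> (g, D))
       (goal_of T True [] A, []) = (g, D)"
    using w unfolding witness_derivation_def Let_def T_def e_def us_def b_def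
    by (auto split: prod.splits)
  ultimately have B: "derivation B D A" "qfree B"
    "\<And>J. sent_eval J B = branch_truth J True Var [] A"
    using back_search[of A g D] A by (auto simp: rectified_def)
  have "sent_eval J B" for J
  proof -
    \<comment> \<open>An interpretation of the final formula is pulled back along \<open>e\<close> to the terms with Skolem symbols.\<close>
    have "truth (\<lambda>p ts. J p (map e ts)) (\<lambda>f. Fun (Sym f)) (\<lambda>t. t) (set T) True Var
          (\<lambda>r y ts. Fun (Sko y) ts) A
        = truth J Fun e (set T) True Var (\<lambda>r y ts. e (Fun (Sko y) ts)) A"
      by (rule truth_hom) (auto simp: e_def)
    moreover have "skolem_truth (\<lambda>p ts. J p (map e ts)) (set T) A"
      using n(2) unfolding property_C_truth[OF A] setT by blast
    ultimately show ?thesis by (simp add: B(3) branch_truth_def)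
  qed
  then show ?thesis using B by (simp add: sentential_tautology_def)
qed

theorem theorem6p3:
  fixes A :: "('f, 'p) fm"
  assumes "rectified A"
  shows "((\<exists>n>0. property_C n A) \<longleftrightarrow>
          (\<exists>B D. sentential_tautology B \<and> derivation B D A))
       \<and> (\<forall>n B D. 0 < n \<and> property_C n A \<and> witness_derivation n A = (B, D) \<longrightarrow>
            sentential_tautology B \<and> derivation B D A)
       \<and> (\<forall>B D. sentential_tautology B \<and> derivation B D A \<longrightarrow>
            0 < witness_order D \<and> property_C (witness_order D) A)"
proof -
  have to_derivation: "sentential_tautology B \<and> derivation B D A"
    if "0 < n" "property_C n A" "witness_derivation n A = (B, D)" for n B D
    using property_C_derivation[OF assms that] .
  have to_order: "0 < witness_order D \<and> property_C (witness_order D) A"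
    if "sentential_tautology B" "derivation B D A" for B D
    using derivation_property_C[OF assms that] by (simp add: witness_order_def)
  have "\<exists>B D. sentential_tautology B \<and> derivation B D A" if "0 < n" "property_C n A" for n
    using to_derivation[OF that] by (cases "witness_derivation n A") blast
  then show ?thesis using to_derivation to_order by blast
qed

end
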